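(* Let $n\geq 3$ and $k\in\{3,\ldots,n\}$ be integers. Consider a $k$th price auction with $n$ risk neutral bidders. Suppose values are independent and identically distributed on $[0,\omega]$ ($0<\omega<\infty$) with distribution function $F(x)=ax^2/2$, where $a>0$. Let $C_\ell=\frac{1}{\ell+1}\binom{2\ell}{\ell}$ be the $\ell$th Catalan number, put $\theta^k_\ell:=\binom{n-2}{k-3-\ell}\frac{C_\ell}{2^\ell}$ for $\ell=0,1,\ldots,k-3$, and define $\beta_k:[0,\omega]\to\mathbb{R}_+$ by $$\beta_k(x)=x+\frac{x}{\binom{n-2}{k-2}}\sum_{\ell=0}^{k-3}(-1)^{\ell}\frac{\theta^k_\ell}{2^{\ell+1}}.$$ Then the following hold. (i) The strategy profile where each bidder has the common strategy $\beta_k$ is the unique symmetric, increasing equilibrium of the $k$th price auction. (ii) If $n$ is sufficiently large compared to $k$ (specifically, $n+4>2k$), then $$x+\frac{k-2}{2(n-2)}x\leq \beta_k(x)\leq x+\frac{7(k-2)}{8(n-2)}x.$$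
   Context: A single object is for sale to bidders $N=\{1,\ldots,n\}$. Bidder $i$'s value for the object is a random variable $X_i$; the $X_i$ are independent and identically distributed on $[0,\omega]$ with distribution function $F$. Bidder $i$ knows the realization $x_i$ of $X_i$, and knows only that the other bidders' values are iid with distribution $F$. Bidders simultaneously place bids. In a $k$th price auction ($n\geq k\geq 2$) the highest bidder wins the object and pays the $k$th highest bid; a bidder who does not win makes no payment. A risk neutral bidder with value $x$ has expected payoff $x\cdot\Pr(\text{win})$ minus its expected payment. A strategy for bidder $i$ is a function $\beta^i:[0,\omega]\to\mathbb{R}_+$ which determines its bid for any value. A strategy profile is symmetric if all bidders have the same strategy in it, and a symmetric strategy profile is increasing if the common strategy is an increasing function. A symmetric profile with common strategy $\beta$ is an equilibrium if no bidder, whatever its value $x\in[0,\omega]$, can raise its expected payoff by unilaterally deviating from the bid $\beta(x)$ to another bid while all other bidders follow $\beta$.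
   Formalization: Uniqueness is proved at every value x in [0,ω) only: raising the bid β_k(ω) at the single value x=ω gives another symmetric, increasing equilibrium, so uniqueness on all of [0,ω] is false; "increasing" is read as strictly increasing. *)

theory Defs
  imports "HOL-Probability.Probability"
begin

text \<open>
  Bidders are the elements of \<open>{1..n}\<close>; a bid vector is a function \<open>bid :: nat \<Rightarrow> real\<close>, of which only
  the values on \<open>{1..n}\<close> matter.
\<close>

definition highest_bidders :: "nat \<Rightarrow> (nat \<Rightarrow> real) \<Rightarrow> nat set" where
  "highest_bidders n bid = {i \<in> {1..n}. \<forall>j\<in>{1..n}. bid j \<le> bid i}"

text \<open>The order statistic counts multiplicities, so it is defined for every \<open>k \<in> {1..n}\<close>.\<close>

definition kth_highest_bid :: "nat \<Rightarrow> nat \<Rightarrow> (nat \<Rightarrow> real) \<Rightarrow> real" where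
  "kth_highest_bid n k bid = rev (sort (map bid [1..<Suc n])) ! (k - 1)"

text \<open>
  Ties for the highest bid are broken uniformly at random. When the opponents use a common strictly
  increasing strategy and values have no atoms, bidder \<open>i\<close> is involved in a tie with probability 0,
  so the choice of this rule is immaterial there.
\<close>

definition win_prob :: "nat \<Rightarrow> nat \<Rightarrow> (nat \<Rightarrow> real) \<Rightarrow> real" where
  "win_prob n i bid =
     (if i \<in> highest_bidders n bid then 1 / real (card (highest_bidders n bid)) else 0)"

text \<open>
  The expected payoff of bidder \<open>i\<close> with value \<open>x\<close> who bids \<open>b\<close> while every other bidder \<open>j\<close>
  bids \<open>\<beta> (X j)\<close>. The value \<open>X i\<close> does not occur, and for independent values
  conditioning on \<open>X i = x\<close> does not change the law of the other values, so the
  expectation is taken over the original space.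
\<close>

definition expected_payoff ::
    "'a measure \<Rightarrow> (nat \<Rightarrow> 'a \<Rightarrow> real) \<Rightarrow> nat \<Rightarrow> nat \<Rightarrow> (real \<Rightarrow> real) \<Rightarrow> nat \<Rightarrow> real \<Rightarrow> real \<Rightarrow> real" where
  "expected_payoff M X n k \<beta> i x b =
     (let bids = (\<lambda>s. (\<lambda>j. \<beta> (X j s))(i := b))
      in x * (\<integral>s. win_prob n i (bids s) \<partial>M)
         - (\<integral>s. win_prob n i (bids s) * kth_highest_bid n k (bids s) \<partial>M))"

text \<open>
  A strategy on \<open>[0, \<omega>]\<close> is represented by a function on the reals; its values outside
  \<open>[0, \<omega>]\<close> are irrelevant, provided that the \<open>X j\<close> take values in \<open>[0, \<omega>]\<close>.
\<close>

definition symmetric_equilibrium ::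
    "'a measure \<Rightarrow> (nat \<Rightarrow> 'a \<Rightarrow> real) \<Rightarrow> nat \<Rightarrow> nat \<Rightarrow> real \<Rightarrow> (real \<Rightarrow> real) \<Rightarrow> bool" where
  "symmetric_equilibrium M X n k \<omega> \<beta> \<longleftrightarrow>
     (\<forall>x\<in>{0..\<omega>}. 0 \<le> \<beta> x) \<and>
     (\<forall>i\<in>{1..n}. \<forall>x\<in>{0..\<omega>}. \<forall>b\<ge>0.
        expected_payoff M X n k \<beta> i x b \<le> expected_payoff M X n k \<beta> i x (\<beta> x))"

definition symmetric_increasing_equilibrium ::
    "'a measure \<Rightarrow> (nat \<Rightarrow> 'a \<Rightarrow> real) \<Rightarrow> nat \<Rightarrow> nat \<Rightarrow> real \<Rightarrow> (real \<Rightarrow> real) \<Rightarrow> bool" where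
  "symmetric_increasing_equilibrium M X n k \<omega> \<beta> \<longleftrightarrow>
     symmetric_equilibrium M X n k \<omega> \<beta> \<and> strict_mono_on {0..\<omega>} \<beta>"

definition catalan :: "nat \<Rightarrow> real" where
  "catalan l = 1 / (real l + 1) * real ((2 * l) choose l)"

definition theta :: "nat \<Rightarrow> nat \<Rightarrow> nat \<Rightarrow> real" where
  "theta n k l = real ((n - 2) choose (k - 3 - l)) * (catalan l / 2 ^ l)"

definition eq_bid :: "nat \<Rightarrow> nat \<Rightarrow> real \<Rightarrow> real" where
  "eq_bid n k x =
     x + x / real ((n - 2) choose (k - 2)) * (\<Sum>l=0..k - 3. (- 1) ^ l * (theta n k l / 2 ^ (l + 1)))"

end

(*
  The equilibrium bid is linear: by Vandermonde's identity and (1/2 choose l+1) = (-1)^l C_l / 2^(2l+1),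
  beta_k(x) = c x with c = (n - 3/2 choose k-2) / (n-2 choose k-2) = prod_{j=n-k+1}^{n-2} (1 + 1/(2j)).
  The variables U_j = (X_j/omega)^2 are uniform, so a bidder who bids like the value z, i.e. at the
  quantile v = (z/omega)^2, has expected payoff
    x v^(n-1) - (n-1) (n-2 choose k-2) int_0^v beta(omega sqrt u) (v-u)^(k-2) u^(n-k) du.
  For beta = beta_k the integral is a Beta integral, and the payoff is maximal at z = x by a tangent
  inequality for powers. Conversely, payoff equivalence determines the payment of any symmetric
  increasing equilibrium, and differentiating the integral k-1 times in v at continuity points of the
  monotone beta recovers beta. The bounds in (ii) come from 1 + sum <= prod and from
  (1 + 1/(2j))^2 <= (j + 3/4)/(j - 1/4), whose right-hand side telescopes.
*)

theory Submission imports Defs begin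

section \<open>The slope of the equilibrium strategy\<close>

text \<open>The constants have one source. Since the distribution function is 1 at \<omega>,
  \<open>a = 2 / \<omega>\<^sup>2\<close>; hence \<open>(X j / \<omega>)\<^sup>2\<close> is F(X_j),
  and \<open>\<omega> * sqrt u\<close> is the quantile function. Its square root adds 1/2 to the
  exponent \<open>n - k\<close> in the payment integral, and the Beta integral then produces
  \<open>(n - 3/2) gchoose (k - 2)\<close>, which the numerator of the slope cancels. The Catalan
  numbers are the expansion of this shift by 1/2. The obstacle in the uniqueness part is that a
  competing strategy is only known to increase and may jump. The Volterra integral is therefore
  differentiated only off a countable set; its continuity restores the vanishing on all of [0,1]
  before the next derivative is taken. This yields agreement off a countable set, which monotonicity
  extends to [0,\<omega>).\<close>

lemma catalan_Suc: "catalan (Suc l) = catalan l * (2 * (2 * real l + 1) / (real l + 2))"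
proof -
  have "real ((2 * Suc l) choose Suc l) * (real l + 1) = 2 * (2 * real l + 1) * real ((2 * l) choose l)"
  proof -
    have central: "real ((2 * m) choose m) = fact (2 * m) / (fact m * fact m)" for m
      by (simp add: binomial_fact mult_2)
    show ?thesis unfolding central by (simp add: divide_simps) (simp add: algebra_simps)
  qed
  then have "real ((2 * Suc l) choose Suc l) = 2 * (2 * real l + 1) * real ((2 * l) choose l) / (real l + 1)"
    by (simp add: eq_divide_eq del: binomial_Suc_Suc)
  then show ?thesis
    unfolding catalan_def by (simp only:) (simp add: divide_simps)
qed

text \<open>Consecutive terms have the same ratio on both sides:
  \<open>(1/2 - (l + 1)) / (l + 2)\<close> equals -1/4 times the Catalan ratio
  \<open>2 * (2 * l + 1) / (l + 2)\<close>.\<close>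

lemma gbinomial_half_Suc: "(1 / 2 :: real) gchoose Suc l = (- 1) ^ l * catalan l / 2 ^ (2 * l + 1)"
proof (induction l)
  case 0
  then show ?case by (simp add: catalan_def)
next
  case (Suc l)
  have "(1 / 2 :: real) gchoose Suc (Suc l)
      = (1 / 2 gchoose Suc l) * ((1 / 2 - real (Suc l)) / real (Suc (Suc l)))"
    using gbinomial_absorb_comp[of "1/2::real" "Suc l"] gbinomial_absorption[of "Suc l" "1/2::real"]
    by (simp add: field_simps)
  also have "\<dots> = (- 1) ^ Suc l * catalan (Suc l) / 2 ^ (2 * Suc l + 1)"
    unfolding Suc catalan_Suc by (simp add: divide_simps) (simp add: algebra_simps)
  finally show ?case .
qed

text \<open>The numerator is kept as a generalized binomial because the Beta integral in
  \<open>payment_slope\<close> produces exactly this number, so that the two cancel.\<close>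

definition slope :: "nat \<Rightarrow> nat \<Rightarrow> real" where
  "slope n k = ((real n - 3 / 2) gchoose (k - 2)) / real ((n - 2) choose (k - 2))"

lemma eq_bid_slope:
  assumes "3 \<le> k" "k \<le> n"
  shows "eq_bid n k x = slope n k * x"
proof -
  have "(\<Sum>l=0..k - 3. (- 1) ^ l * (theta n k l / 2 ^ (l + 1)))
      = (\<Sum>l=0..k - 3. ((1 / 2 :: real) gchoose Suc l) * (real (n - 2) gchoose (k - 2 - Suc l)))"
  proof (rule sum.cong)
    fix l assume "l \<in> {0..k - 3}"
    have pow: "(2::real) ^ (2 * l + 1) = 2 ^ l * 2 ^ (l + 1)"
    proof -
      have "2 * l + 1 = l + (l + 1)" by simp
      then show ?thesis by (simp only: power_add)
    qed
    have idx: "k - 3 - l = k - 2 - Suc l" by simp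
    show "(- 1) ^ l * (theta n k l / 2 ^ (l + 1))
        = ((1 / 2 :: real) gchoose Suc l) * (real (n - 2) gchoose (k - 2 - Suc l))"
      unfolding theta_def gbinomial_half_Suc pow idx by (simp flip: binomial_gbinomial)
  qed simp
  also have "\<dots> = (\<Sum>l=1..k - 2. ((1 / 2 :: real) gchoose l) * (real (n - 2) gchoose (k - 2 - l)))"
  proof -
    have "Suc (k - 3) = k - 2" using assms by simp
    then show ?thesis
      using sum.shift_bounds_cl_Suc_ivl[of "\<lambda>l. ((1 / 2 :: real) gchoose l) * (real (n - 2) gchoose (k - 2 - l))" 0 "k - 3"]
      by simp
  qed
  \<comment> \<open>The full convolution has one more term, of index 0, equal to
    \<open>(n - 2) choose (k - 2)\<close>. It corresponds to the summand \<open>x\<close> that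
    stands apart in \<open>eq_bid\<close>.\<close>
  also have "\<dots> = (real n - 3 / 2 gchoose (k - 2)) - real ((n - 2) choose (k - 2))"
  proof -
    have half: "1 / 2 + real (n - 2) = real n - 3 / 2"
      using assms by (simp add: of_nat_diff)
    show ?thesis
      unfolding half[symmetric] gbinomial_Vandermonde[symmetric] sum.atLeast_Suc_atMost[OF le0]
      by (simp flip: binomial_gbinomial)
  qed
  finally have sum: "(\<Sum>l=0..k - 3. (- 1) ^ l * (theta n k l / 2 ^ (l + 1)))
      = (real n - 3 / 2 gchoose (k - 2)) - real ((n - 2) choose (k - 2))" .
  have "real ((n - 2) choose (k - 2)) \<noteq> 0"
    using assms by simp
  then show ?thesis
    unfolding eq_bid_def sum slope_def by (simp add: divide_simps) (simp add: algebra_simps)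
qed

section \<open>Product form of the slope and the two bounds on it\<close>

lemma slope_eq_prod:
  assumes "3 \<le> k" "k \<le> n"
  shows "slope n k = (\<Prod>i<k - 2. 1 + 1 / (2 * (real (n - 2) - real i)))"
proof -
  have "slope n k = (\<Prod>i = 0..<k - 2. ((real n - 3 / 2) - real i) / (real (n - 2) - real i))"
    unfolding slope_def binomial_gbinomial gbinomial_prod_rev prod_dividef by simp
  also have "\<dots> = (\<Prod>i<k - 2. 1 + 1 / (2 * (real (n - 2) - real i)))"
    using assms by (intro prod.cong) (auto simp: field_simps of_nat_diff)
  finally show ?thesis .
qed

text \<open>The shift 1/4 makes \<open>(j + 3/4) / (j - 1/4) = 1 + 1 / (j - 1/4)\<close> agree with
  \<open>(1 + 1 / (2 * j))\<^sup>2\<close> up to order 1/j^2, and the remaining gap is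
  \<open>1 / (16 * j\<^sup>2 * (j - 1/4))\<close>. The denominator at j is the numerator at j - 1,
  whence the telescoping.\<close>

lemma prod_half_le:
  assumes "r \<le> m"
  shows "(\<Prod>i<r. 1 + 1 / (2 * (real m - real i)))\<^sup>2 \<le> (m + 3 / 4) / (real m - r + 3 / 4)"
  using assms
proof (induction r)
  case (Suc r)
  let ?j = "real m - real r"
  have j: "?j \<ge> 1" using Suc.prems by linarith
  have "(\<Prod>i<Suc r. 1 + 1 / (2 * (real m - real i)))\<^sup>2
      = (\<Prod>i<r. 1 + 1 / (2 * (real m - real i)))\<^sup>2 * (1 + 1 / (2 * ?j))\<^sup>2"
    by (simp add: power_mult_distrib)
  also have "\<dots> \<le> (m + 3 / 4) / (?j + 3 / 4) * (1 + 1 / (2 * ?j))\<^sup>2"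
    using Suc by (intro mult_right_mono) auto
  also have "(1 + 1 / (2 * ?j))\<^sup>2 \<le> (?j + 3 / 4) / (?j - 1 / 4)"
  proof -
    have "(1 + 1 / (2 * y))\<^sup>2 \<le> (y + 3 / 4) / (y - 1 / 4)" if "y \<ge> 1" for y :: real
    proof -
      have "(y + 3 / 4) / (y - 1 / 4) - (1 + 1 / (2 * y))\<^sup>2 = 1 / (16 * y\<^sup>2 * (y - 1 / 4))"
        using that by (simp add: divide_simps power2_eq_square) (simp add: algebra_simps)
      also have "\<dots> \<ge> 0" using that by simp
      finally show ?thesis by simp
    qed
    then show ?thesis using j .
  qed
  then have "(m + 3 / 4) / (?j + 3 / 4) * (1 + 1 / (2 * ?j))\<^sup>2
    \<le> (m + 3 / 4) / (?j + 3 / 4) * ((?j + 3 / 4) / (?j - 1 / 4))"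
    using j by (intro mult_left_mono) auto
  also have "\<dots> = (m + 3 / 4) / (real m - Suc r + 3 / 4)"
    using j by (simp add: divide_simps)
  finally show ?case .
qed auto

lemma one_plus_sum_le_prod:
  fixes f :: "'a \<Rightarrow> real"
  assumes "finite A" "\<And>x. x \<in> A \<Longrightarrow> 0 \<le> f x"
  shows "1 + sum f A \<le> (\<Prod>x\<in>A. 1 + f x)"
  using assms
proof (induction A rule: finite_induct)
  case (insert x A)
  have "f x * 1 \<le> f x * (\<Prod>x\<in>A. 1 + f x)"
    using insert.prems by (intro mult_left_mono prod_ge_1) auto
  then show ?case
    using insert by (simp add: algebra_simps)
qed simp

lemma slope_ge:
  assumes "3 \<le> k" "k \<le> n"
  shows "slope n k \<ge> 1 + real (k - 2) / (2 * real (n - 2))"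
proof -
  have "1 + (\<Sum>i<k - 2. 1 / (2 * real (n - 2))) \<le> 1 + (\<Sum>i<k - 2. 1 / (2 * (real (n - 2) - real i)))"
    using assms by (intro add_left_mono sum_mono divide_left_mono) auto
  also have "\<dots> \<le> (\<Prod>i<k - 2. 1 + 1 / (2 * (real (n - 2) - real i)))"
    using assms by (intro one_plus_sum_le_prod) auto
  finally show ?thesis
    using assms by (simp add: slope_eq_prod)
qed

lemma slope_le:
  assumes "3 \<le> k" "k \<le> n" "n + 4 > 2 * k"
  shows "slope n k \<le> 1 + 7 * real (k - 2) / (8 * real (n - 2))"
proof (rule power2_le_imp_le)
  define m r where "m = n - 2" and "r = k - 2"
  have mr: "1 \<le> real r" "real r \<le> real m" "2 * real r - 1 \<le> real m" "r \<le> m"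
    using assms by (auto simp: m_def r_def)
  \<comment> \<open>The quadratic in \<open>key\<close> is the nontrivial factor of the numerator
    when the two bounds on the squared slope are subtracted below. To see its sign, divide it by
    \<open>m - (2 * r - 1)\<close> as a polynomial in m, then divide the remainder by
    \<open>r - 1\<close>; quotients and the last remainder are nonnegative for
    \<open>m \<ge> 2 * r - 1\<close> and \<open>r \<ge> 1\<close>. With the constant 7/8 the leading
    form at \<open>m = 2 * r\<close> is still positive, namely
    \<open>17 * r\<^sup>2\<close>.\<close>
  have "0 \<le> (real r - 1) * (17 * real r + 92.75) + 56.75 "
    using mr by simp
  also have "\<dots> \<le> (real r - 1) * (17 * real r + 92.75) + 56.75 + (real m - (2 * real r - 1)) * (48 * (real m - 1) + 33 * real r  + 84)"
    using mr by simp
  also have "\<dots> = 48 * real m^2 - 63 * real m * real r - 49 * real r^2 + 84 * real m + 36.75 * real r"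
    by (simp add: field_simps power2_eq_square)
  finally have key: "0 \<le> 48 * real m^2 - 63 * real m * real r - 49 * real r^2 + 84 * real m + 36.75 * real r" .
  have "slope n k ^ 2 \<le> (m + 3 / 4) / (real m - r + 3 / 4)"
    using prod_half_le[OF mr(4)] assms by (simp add: slope_eq_prod m_def r_def)
  also have "\<dots> \<le> (1 + 7 * real r / (8 * real m))\<^sup>2"
  proof -
    have "(1 + 7 * real r / (8 * real m))\<^sup>2 - (m + 3 / 4) / (real m - r + 3 / 4)
      = real r * (48 * real m^2 - 63 * real m * real r - 49 * real r^2 + 84 * real m + 36.75 * real r)
        / (64 * real m ^ 2 * (real m - r + 3 / 4))"
      using mr by (simp add: divide_simps power2_eq_square) (simp add: algebra_simps)
    also have "\<dots> \<ge> 0" using mr key by (intro divide_nonneg_nonneg mult_nonneg_nonneg) auto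
    finally show ?thesis by simp
  qed
  finally show "(slope n k)\<^sup>2 \<le> (1 + 7 * real (k - 2) / (8 * real (n - 2)))\<^sup>2"
    by (simp add: m_def r_def)
qed simp

text \<open>This is the Beta function B(p+1, m+1) scaled to [0,v]. The exponent p is real because it
  will be \<open>n - k + 1/2\<close>. Writing \<open>(v - u) ^ Suc m\<close> as
  \<open>v * (v - u) ^ m - u * (v - u) ^ m\<close> reduces m at the price of raising p by 1, so the
  induction needs p arbitrary.\<close>

lemma has_integral_powr_mult_diff_power:
  fixes p v :: real
  assumes "0 \<le> p" "0 \<le> v"
  shows "((\<lambda>u. u powr p * (v - u) ^ m) has_integral
           v powr (p + m + 1) / ((p + m + 1) * ((p + m) gchoose m))) {0..v}"
  using assms
proof (induction m arbitrary: p)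
  case 0
  then show ?case
    using has_integral_powr_from_0[of p v] by simp
next
  case (Suc m)
  let ?G = "(p + m) gchoose m"
  have G: "?G > 0"
    using Suc.prems by (subst gbinomial_pochhammer') (auto intro!: divide_pos_pos pochhammer_pos)
  have pG: "(p + Suc m) gchoose Suc m = (p + m + 1) / (m + 1) * ?G"
  proof -
    have "p + real (Suc m) = p + m + 1" by simp
    then show ?thesis
      by (simp only: gbinomial_factors) (simp add: add_ac)
  qed
  have "(p + 1) * (p + 1 + m gchoose m) = (p + m + 1) * ?G"
    using gbinomial_absorb_comp[of "p + 1 + m" m] by (simp add: algebra_simps)
  then have qG: "(p + 1 + m) gchoose m = (p + m + 1) * ?G / (p + 1)"
    using Suc.prems by (simp add: field_simps)
  have "((\<lambda>u. v * (u powr p * (v - u) ^ m) - u powr (p + 1) * (v - u) ^ m) has_integral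
          v * (v powr (p + m + 1) / ((p + m + 1) * ?G))
          - v powr (p + 1 + m + 1) / ((p + 1 + m + 1) * ((p + 1 + m) gchoose m))) {0..v}"
    using Suc.prems by (intro has_integral_diff has_integral_mult_right Suc.IH) auto
  also have "v * (v powr (p + m + 1) / ((p + m + 1) * ?G))
          - v powr (p + 1 + m + 1) / ((p + 1 + m + 1) * ((p + 1 + m) gchoose m))
      = v powr (p + Suc m + 1) / ((p + Suc m + 1) * ((p + Suc m) gchoose Suc m))"
  proof -
    have v: "v * v powr (p + m + 1) = v powr (p + Suc m + 1)" "v powr (p + 1 + m + 1) = v powr (p + Suc m + 1)"
      using Suc.prems by (auto simp: powr_mult_base add_ac)
    have "1 / ((p + m + 1) * ?G) - 1 / ((p + 1 + m + 1) * ((p + 1 + m) gchoose m))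
      = 1 / ((p + Suc m + 1) * ((p + Suc m) gchoose Suc m))"
    proof -
      have "1 / (q * g) - 1 / ((q + 1) * (q * g / (p + 1))) = 1 / ((q + 1) * (q / (m + 1) * g))"
        if "q > 0" "g > 0" "q = p + m + 1" for q g :: real
        using Suc.prems that by (simp add: divide_simps)
      from this[of "p + m + 1" ?G] show ?thesis
        using G Suc.prems unfolding qG pG by (simp add: add_ac)
    qed
    then have "v powr (p + Suc m + 1) * (1 / ((p + m + 1) * ?G) - 1 / ((p + 1 + m + 1) * ((p + 1 + m) gchoose m)))
      = v powr (p + Suc m + 1) * (1 / ((p + Suc m + 1) * ((p + Suc m) gchoose Suc m)))" by simp
    then show ?thesis using v by (simp add: right_diff_distrib)
  qed
  finally show ?case
  proof (rule has_integral_eq[rotated])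
    fix u assume "u \<in> {0..v}"
    then have "u powr (p + 1) = u * u powr p"
      by (simp add: powr_mult_base add.commute)
    then show "v * (u powr p * (v - u) ^ m) - u powr (p + 1) * (v - u) ^ m = u powr p * (v - u) ^ Suc m"
      by (simp only: power_Suc) (simp only: algebra_simps)
  qed
qed

text \<open>With \<open>r = x / \<omega>\<close>, \<open>s = z / \<omega>\<close> and
  \<open>N = 2 * n - 2\<close> this compares, up to the factor \<omega>, the payoff from imitating z
  with that from bidding truthfully according to x. Multiplied by N + 1 it says that the convex
  function t^(N+1) lies above its tangent at s.\<close>

lemma power_tangent_le:
  fixes r s :: real
  assumes "0 \<le> r" "0 \<le> s"
  shows "r * s ^ N - real N / (real N + 1) * s ^ (N + 1) \<le> r * r ^ N - real N / (real N + 1) * r ^ (N + 1)"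
proof -
  have *: "(real N + 1) * r * s ^ N \<le> N * s ^ (N + 1) + r ^ (N + 1)"
  proof (induction N)
    case (Suc N)
    have "0 \<le> (s - r) * (s ^ Suc N - r ^ Suc N)"
      using assms by (cases "r \<le> s") (auto intro!: mult_nonneg_nonneg mult_nonpos_nonpos power_mono simp del: power_Suc)
    then have "r * s ^ Suc N + r^Suc N * s  \<le> s ^ (Suc N + 1) + r ^ (Suc N + 1)"
      by (simp add: algebra_simps)
    moreover have "s * ((real N + 1) * r * s ^ N) \<le> s * (N * s ^ (N + 1) + r ^ (N + 1))"
      using Suc assms by (intro mult_left_mono)
    ultimately show ?case by (simp add: algebra_simps)
  qed simp
  define c where "c = real N + 1"
  have "c > 0" by (simp add: c_def)
  have "r * s ^ N - real N / c * s ^ (N + 1) = (c * r * s ^ N - real N * s ^ (N + 1)) / c"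
    using \<open>c > 0\<close> by (simp add: diff_divide_distrib)
  also have "\<dots> \<le> r ^ (N + 1) / c"
    using * \<open>c > 0\<close> by (intro divide_right_mono) (auto simp: c_def)
  also have "\<dots> = r * r ^ N - real N / c * r ^ (N + 1)"
    by (simp add: c_def divide_simps) (simp add: algebra_simps)
  finally show ?thesis by (simp add: c_def)
qed

section \<open>Inverting a Volterra integral with kernel $(v-u)^m$\<close>

text \<open>An increasing strategy may be discontinuous, so integrability has to come from
  measurability and a bound.\<close>

lemma integrable_on_bounded_borel:
  fixes f :: "real \<Rightarrow> real"
  assumes [measurable]: "f \<in> borel_measurable borel" and "\<And>x. x \<in> {a..b} \<Longrightarrow> \<bar>f x\<bar> \<le> C"
  shows "f integrable_on {a..b}"
proof (rule set_borel_integral_eq_integral(1))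
  show "set_integrable lborel {a..b} f"
    unfolding set_integrable_def real_scaleR_def
  proof (rule integrableI_bounded_set[where A = "{a..b}" and B = C])
    show "emeasure lborel {a..b} < \<infinity>" by (simp add: emeasure_lborel_Icc_eq)
  qed (use assms(2) in auto)
qed

text \<open>Splitting off one factor \<open>w - u\<close> takes the parameter out of the integral,
  which for \<open>w = v\<close> avoids differentiating under the integral sign. The price is that f
  is replaced by \<open>u * f u\<close>; assuming integrability for every \<open>u ^ j * f u\<close>
  makes the hypothesis stable under this replacement.\<close>

lemma
  fixes f :: "real \<Rightarrow> real"
  assumes "\<And>j. (\<lambda>u. u ^ j * f u) integrable_on {0..1}"
  shows integrable_on_mult_diff_power: "(\<lambda>u. f u * (w - u) ^ m) integrable_on {0..1}"
    and integral_mult_diff_power_Suc: "v \<in> {0..1} \<Longrightarrow>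
      integral {0..v} (\<lambda>u. f u * (w - u) ^ Suc m)
      = w * integral {0..v} (\<lambda>u. f u * (w - u) ^ m) - integral {0..v} (\<lambda>u. u * f u * (w - u) ^ m)"
proof -
  have shift: "(\<lambda>u. u ^ j * (u * f u)) integrable_on {0..1}"
    if "\<And>j. (\<lambda>u. u ^ j * f u) integrable_on {0..1}" for j and f :: "real \<Rightarrow> real"
    using that[of "Suc j"] by (simp add: mult_ac)
  have split: "f u * (w - u) ^ Suc m = w * (f u * (w - u) ^ m) - u * f u * (w - u) ^ m" for u m and f :: "real \<Rightarrow> real"
    by (simp add: algebra_simps)
  have int: "(\<lambda>u. f u * (w - u) ^ m) integrable_on {0..1}"
    if "\<And>j. (\<lambda>u. u ^ j * f u) integrable_on {0..1}" for f m
    using that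
  proof (induction m arbitrary: f)
    case 0
    from 0[of 0] show ?case by simp
  next
    case (Suc m)
    show ?case
      unfolding split by (intro integrable_diff integrable_on_mult_right Suc.IH shift Suc.prems)
  qed
  show "(\<lambda>u. f u * (w - u) ^ m) integrable_on {0..1}"
    by (rule int[OF assms])
  assume v: "v \<in> {0..1}"
  have sub: "h integrable_on {0..v}" if "h integrable_on {0..1}" for h :: "real \<Rightarrow> real"
    using integrable_on_subinterval[OF that, of 0 v] v by simp
  show "integral {0..v} (\<lambda>u. f u * (w - u) ^ Suc m)
      = w * integral {0..v} (\<lambda>u. f u * (w - u) ^ m) - integral {0..v} (\<lambda>u. u * f u * (w - u) ^ m)"
    unfolding split
    by (subst integral_diff) (auto intro!: integrable_on_mult_right sub int shift assms)
qed

lemma continuous_on_integral_mult_diff_power: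
  fixes f :: "real \<Rightarrow> real"
  assumes "\<And>j. (\<lambda>u. u ^ j * f u) integrable_on {0..1}"
  shows "continuous_on {0..1} (\<lambda>v. integral {0..v} (\<lambda>u. f u * (v - u) ^ m))"
  using assms
proof (induction m arbitrary: f)
  case 0
  from 0[of 0] show ?case by (simp add: indefinite_integral_continuous_1)
next
  case (Suc m)
  have "(\<lambda>u. u ^ j * (u * f u)) integrable_on {0..1}" for j
    using Suc.prems[of "Suc j"] by (simp add: mult_ac)
  then have "continuous_on {0..1} (\<lambda>v. integral {0..v} (\<lambda>u. u * f u * (v - u) ^ m))"
    by (intro Suc.IH)
  then have "continuous_on {0..1} (\<lambda>v. v * integral {0..v} (\<lambda>u. f u * (v - u) ^ m)
      - integral {0..v} (\<lambda>u. u * f u * (v - u) ^ m))"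
    by (intro continuous_on_diff continuous_on_mult continuous_on_id Suc.IH[OF Suc.prems])
  then show ?case
    by (rule continuous_on_cong[THEN iffD1, OF refl, rotated])
      (rule integral_mult_diff_power_Suc[OF Suc.prems, symmetric])
qed

lemma DERIV_integral_upper:
  fixes f :: "real \<Rightarrow> real"
  assumes "f integrable_on {0..1}" "v \<in> {0<..<1}" "isCont f v"
  shows "((\<lambda>v. integral {0..v} f) has_real_derivative f v) (at v)"
proof -
  have "((\<lambda>v. integral {0..v} f) has_vector_derivative f v) (at v within {0..1} - {})"
    using assms by (intro integral_has_vector_derivative_continuous_at) (auto intro: continuous_at_imp_continuous_at_within)
  then show ?thesis
    using assms(2) by (simp add: has_real_derivative_iff_has_vector_derivative at_within_Icc_at)
qed

text \<open>The kernel vanishes at \<open>u = v\<close>, so no boundary term appears: in the base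
  case the two contributions \<open>v * f v\<close> cancel. The step is the product rule applied to
  the recursion \<open>integral_mult_diff_power_Suc\<close>.\<close>

lemma DERIV_integral_mult_diff_power:
  fixes f :: "real \<Rightarrow> real"
  assumes "\<And>j. (\<lambda>u. u ^ j * f u) integrable_on {0..1}" "v \<in> {0<..<1}" "isCont f v"
  shows "((\<lambda>v. integral {0..v} (\<lambda>u. f u * (v - u) ^ Suc m)) has_real_derivative
           Suc m * integral {0..v} (\<lambda>u. f u * (v - u) ^ m)) (at v)"
  using assms
proof (induction m arbitrary: f)
  case 0
  have int: "f integrable_on {0..1}" "(\<lambda>u. u * f u) integrable_on {0..1}"
    using 0(1)[of 0] 0(1)[of 1] by auto
  have "((\<lambda>v. v * integral {0..v} f - integral {0..v} (\<lambda>u. u * f u)) has_real_derivative integral {0..v} f) (at v)"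
    by (rule derivative_eq_intros DERIV_integral_upper int 0 refl continuous_intros | simp)+
  then show ?case
    by (rule has_field_derivative_transform_within_open[OF _ open_greaterThanLessThan, of _ _ _ 0 1, THEN DERIV_cong])
      (use 0(2) integral_mult_diff_power_Suc[OF 0(1), of _ _ 0] in auto)
next
  case (Suc m)
  let ?I = "\<lambda>f m v. integral {0..v} (\<lambda>u. f u * (v - u) ^ m)"
  let ?g = "\<lambda>u. u * f u"
  have g: "(\<lambda>u. u ^ j * ?g u) integrable_on {0..1}" for j
    using Suc.prems(1)[of "Suc j"] by (simp add: mult_ac)
  have "((\<lambda>v. v * ?I f (Suc m) v - ?I ?g (Suc m) v) has_real_derivative
      (1 * ?I f (Suc m) v + (Suc m * ?I f m v) * v - Suc m * ?I ?g m v)) (at v)"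
    using Suc.prems g by (intro DERIV_diff DERIV_mult DERIV_ident Suc.IH continuous_intros)
  moreover have "1 * ?I f (Suc m) v + (Suc m * ?I f m v) * v - Suc m * ?I ?g m v = Suc (Suc m) * ?I f (Suc m) v"
  proof -
    have "1 * (v * A - B) + (Suc m * A) * v - Suc m * B = Suc (Suc m) * (v * A - B)" for A B :: real
      by (simp add: algebra_simps)
    moreover have "?I f (Suc m) v = v * ?I f m v - ?I ?g m v"
      using Suc.prems(2) by (intro integral_mult_diff_power_Suc Suc.prems(1)) auto
    ultimately show ?thesis by metis
  qed
  ultimately have "((\<lambda>v. v * ?I f (Suc m) v - ?I ?g (Suc m) v) has_real_derivative Suc (Suc m) * ?I f (Suc m) v) (at v)"
    by simp
  then show ?case
    by (rule has_field_derivative_transform_within_open[OF _ open_greaterThanLessThan, of _ _ _ 0 1])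
      (use Suc.prems(2) integral_mult_diff_power_Suc[OF Suc.prems(1), of _ _ "Suc m"] in auto)
qed

text \<open>The zero set of h is closed, and the complement of a countable set is dense because
  nonempty open intervals are uncountable.\<close>

lemma eq_0_off_countable_imp_eq_0:
  fixes h :: "real \<Rightarrow> real"
  assumes h: "continuous_on {0..1} h" and D: "countable D" "\<And>v. v \<in> {0<..<1} - D \<Longrightarrow> h v = 0"
    and v: "v \<in> {0..1}"
  shows "h v = 0"
proof -
  have "v \<in> closure ({0<..<1} - D)"
  proof (subst closure_approachable, intro allI impI)
    fix e :: real assume "e > 0"
    then have "max 0 (v - e) < min 1 (v + e)" using v by auto
    then have "uncountable ({max 0 (v - e)<..<min 1 (v + e)} - D)"
      using D(1) uncountable_minus_countable uncountable_open_interval by blast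
    then obtain y where "y \<in> {max 0 (v - e)<..<min 1 (v + e)} - D"
      by (metis countable_empty equals0I)
    then show "\<exists>y\<in>{0<..<1} - D. dist y v < e"
      by (intro bexI[of _ y]) (auto simp: dist_real_def)
  qed
  moreover have "closed ({0..1} \<inter> h -` {0})"
    using h by (intro continuous_closed_preimage) auto
  moreover have "{0<..<1} - D \<subseteq> {0..1} \<inter> h -` {0}"
    using D(2) by auto
  ultimately show ?thesis
    using closure_minimal[of "{0<..<1} - D" "{0..1} \<inter> h -` {0}"] by auto
qed

text \<open>Each differentiation lowers the exponent of the kernel by one, but only at continuity
  points of f; \<open>eq_0_off_countable_imp_eq_0\<close> closes the gap between rounds. The last
  differentiation, at exponent 0, gives f itself.\<close>

lemma eq_0_if_integral_mult_diff_power_eq_0: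
  fixes f :: "real \<Rightarrow> real"
  assumes int: "\<And>j. (\<lambda>u. u ^ j * f u) integrable_on {0..1}"
    and D: "countable D" "\<And>v. v \<in> {0<..<1} - D \<Longrightarrow> isCont f v"
    and eq0: "\<And>v. v \<in> {0..1} \<Longrightarrow> integral {0..v} (\<lambda>u. f u * (v - u) ^ m) = 0"
    and v: "v \<in> {0<..<1} - D"
  shows "f v = 0"
  using eq0
proof (induction m)
  case 0
  have "((\<lambda>v. integral {0..v} f) has_real_derivative f v) (at v)"
    using int[of 0] D(2) v by (intro DERIV_integral_upper) auto
  then have "((\<lambda>_. 0) has_real_derivative f v) (at v)"
    by (rule has_field_derivative_transform_within_open[OF _ open_greaterThanLessThan, of _ _ _ 0 1])
      (use 0 v in auto)
  then show ?case
    using DERIV_unique[OF _ DERIV_const] by blast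
next
  case (Suc m)
  let ?I = "\<lambda>m v. integral {0..v} (\<lambda>u. f u * (v - u) ^ m)"
  have "?I m v = 0" if "v \<in> {0<..<1} - D" for v
  proof -
    have "(?I (Suc m) has_real_derivative Suc m * ?I m v) (at v)"
      using that D(2) by (intro DERIV_integral_mult_diff_power int) auto
    then have "((\<lambda>_. 0) has_real_derivative Suc m * ?I m v) (at v)"
      by (rule has_field_derivative_transform_within_open[OF _ open_greaterThanLessThan, of _ _ _ 0 1])
        (use Suc.prems that in auto)
    then have "Suc m * ?I m v = 0"
      using DERIV_unique[OF _ DERIV_const] by blast
    then show ?thesis by simp
  qed
  then have "?I m v = 0" if "v \<in> {0..1}" for v
    using eq_0_off_countable_imp_eq_0[OF continuous_on_integral_mult_diff_power[OF int, of m] D(1) _ that] by blast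
  then show ?case by (rule Suc.IH)
qed

section \<open>Order statistics of independent uniform values\<close>

lemma sorted_less_nth_iff:
  fixes ys :: "'a :: linorder list"
  assumes "sorted ys" "i < length ys"
  shows "t < ys ! i \<longleftrightarrow> length ys - i \<le> length (filter ((<) t) ys)"
proof
  assume "t < ys ! i"
  then have "{i..<length ys} \<subseteq> {j. j < length ys \<and> t < ys ! j}"
    using assms sorted_nth_mono[of ys i] by (force intro: less_le_trans)
  from card_mono[OF _ this] show "length ys - i \<le> length (filter ((<) t) ys)"
    by (simp add: length_filter_conv_card)
next
  assume *: "length ys - i \<le> length (filter ((<) t) ys)"
  show "t < ys ! i"
  proof (rule ccontr)
    assume "\<not> t < ys ! i"
    then have "{j. j < length ys \<and> t < ys ! j} \<subseteq> {Suc i..<length ys}"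
    proof safe
      fix j assume j: "j < length ys" "t < ys ! j"
      have "ys ! j \<le> ys ! i" if "j \<le> i"
        by (rule sorted_nth_mono[OF assms(1) that assms(2)])
      then show "j \<in> {Suc i..<length ys}"
        using j \<open>\<not> t < ys ! i\<close> by (cases "j \<le> i") auto
    qed
    from card_mono[OF _ this] * show False
      using assms(2) by (simp add: length_filter_conv_card)
  qed
qed

text \<open>Counting bids above a threshold replaces sorting, both for measurability and for
  evaluating the price. Position \<open>k - 1\<close> from the top is position \<open>n - k\<close>
  in ascending order, and k entries start there.\<close>

lemma less_kth_highest_bid_iff:
  assumes "1 \<le> k" "k \<le> n"
  shows "t < kth_highest_bid n k bid \<longleftrightarrow> k \<le> card {j \<in> {1..n}. t < bid j}"
proof -
  let ?xs = "map bid [1..<Suc n]"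
  have "kth_highest_bid n k bid = sort ?xs ! (n - k)"
    using assms by (simp add: kth_highest_bid_def rev_nth del: upt_Suc)
  moreover have "length (filter ((<) t) (sort ?xs)) = card {j \<in> {1..n}. t < bid j}"
  proof -
    have "length (filter ((<) t) (sort ?xs)) = length (filter (\<lambda>j. t < bid j) [1..<Suc n])"
      by (simp add: filter_sort filter_map comp_def del: upt_Suc)
    also have "\<dots> = card (set (filter (\<lambda>j. t < bid j) [1..<Suc n]))"
      by (rule distinct_card[symmetric]) simp
    also have "set (filter (\<lambda>j. t < bid j) [1..<Suc n]) = {j \<in> {1..n}. t < bid j}"
      by auto
    finally show ?thesis .
  qed
  ultimately show ?thesis
    using assms sorted_less_nth_iff[of "sort ?xs" "n - k" t] by (simp del: upt_Suc)
qed

lemma kth_highest_bid_eqI: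
  assumes "1 \<le> k" "k \<le> n" "j \<in> {1..n}" "card {l \<in> {1..n}. bid j < bid l} = k - 1"
  shows "kth_highest_bid n k bid = bid j"
proof (rule antisym)
  show "kth_highest_bid n k bid \<le> bid j"
    using assms less_kth_highest_bid_iff[of k n "bid j" bid] by auto
  show "bid j \<le> kth_highest_bid n k bid"
  proof (rule ccontr)
    assume "\<not> ?thesis"
    then have *: "kth_highest_bid n k bid < bid j" by simp
    then have "insert j {l \<in> {1..n}. bid j < bid l} \<subseteq> {l \<in> {1..n}. kth_highest_bid n k bid < bid l}"
      using assms(3) by auto
    from card_mono[OF _ this] have "Suc (k - 1) \<le> card {l \<in> {1..n}. kth_highest_bid n k bid < bid l}"
      using assms(4) by (simp add: card_insert_disjoint)
    then show False
      using less_kth_highest_bid_iff[of k n "kth_highest_bid n k bid" bid] assms by simp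
  qed
qed

lemma borel_measurable_kth_highest_bid:
  assumes "1 \<le> k" "k \<le> n" and [measurable]: "\<And>j. j \<in> {1..n} \<Longrightarrow> (\<lambda>s. bid s j) \<in> borel_measurable M"
  shows "(\<lambda>s. kth_highest_bid n k (bid s)) \<in> borel_measurable M"
proof (rule borel_measurable_iff_greater[THEN iffD2], rule allI)
  fix t
  have "{s \<in> space M. t < kth_highest_bid n k (bid s)}
      = {s \<in> space M. real k \<le> (\<Sum>j\<in>{1..n}. if t < bid s j then 1 else 0)}"
    using assms by (simp add: less_kth_highest_bid_iff sum.If_cases Int_def)
  also have "\<dots> \<in> sets M" by measurable
  finally show "{s \<in> space M. t < kth_highest_bid n k (bid s)} \<in> sets M" .
qed

lemma borel_measurable_win_prob:
  assumes "i \<in> {1..n}" and [measurable]: "\<And>j. j \<in> {1..n} \<Longrightarrow> (\<lambda>s. bid s j) \<in> borel_measurable M"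
  shows "(\<lambda>s. win_prob n i (bid s)) \<in> borel_measurable M"
proof -
  have "win_prob n i b = (if \<forall>j\<in>{1..n}. b j \<le> b i
      then 1 / (\<Sum>l\<in>{1..n}. if \<forall>j\<in>{1..n}. b j \<le> b l then 1 else 0) else 0)" for b
    using assms(1) by (simp add: win_prob_def highest_bidders_def sum.If_cases Int_def)
  moreover have [measurable]: "(\<lambda>s. bid s i) \<in> borel_measurable M" using assms by auto
  ultimately show ?thesis by simp
qed

text \<open>Without ties every rank is attained exactly once. This provides the unique opponent
  whose bid is the price.\<close>

lemma bij_betw_rank:
  fixes x :: "'b \<Rightarrow> 'c :: linorder"
  assumes "finite I" "inj_on x I"
  shows "bij_betw (\<lambda>j. card {l \<in> I. x j < x l}) I {..<card I}"
proof -
  let ?r = "\<lambda>j. card {l \<in> I. x j < x l}"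
  have less: "?r j' < ?r j" if "j \<in> I" "j' \<in> I" "x j < x j'" for j j'
    using that assms(1) by (intro psubset_card_mono) auto
  have inj: "inj_on ?r I"
  proof (rule inj_onI)
    fix j j' assume "j \<in> I" "j' \<in> I" "?r j = ?r j'"
    then have "x j = x j'"
      using less[of j j'] less[of j' j] by (cases "x j" "x j'" rule: linorder_cases) auto
    then show "j = j'" using inj_onD[OF assms(2)] \<open>j \<in> I\<close> \<open>j' \<in> I\<close> by blast
  qed
  have "?r ` I \<subseteq> {..<card I}"
    using assms(1) by (auto intro!: psubset_card_mono)
  then have "?r ` I = {..<card I}"
    using card_image[OF inj] by (intro card_subset_eq) auto
  then show ?thesis using inj by (simp add: bij_betw_def)
qed

section \<open>Winning probability and expected payment for independent uniform quantiles\<close>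

locale uniform_values = prob_space M for M :: "'a measure" +
  fixes U :: "nat \<Rightarrow> 'a \<Rightarrow> real" and n :: nat
  assumes indep: "indep_vars (\<lambda>_. borel) U {1..n}"
    and distr_U: "i \<in> {1..n} \<Longrightarrow> distr M borel (U i) = uniform_measure lborel {0..1}"
begin

abbreviation \<nu> :: "real measure" where "\<nu> \<equiv> uniform_measure lborel {0..1}"

lemma measurable_U [measurable]: "i \<in> {1..n} \<Longrightarrow> U i \<in> borel_measurable M"
  using indep by (auto simp: indep_vars_def)

lemma prob_space_\<nu>: "prob_space \<nu>"
  by (intro prob_space_uniform_measure) auto

text \<open>Conditioning on \<open>U j = u\<close>: the joint law is a product measure, so Fubini
  isolates coordinate j and the remaining factors integrate separately. Each factor may depend on u,
  as needed for comparisons with \<open>U j\<close>.\<close>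

lemma nn_integral_prod_others:
  fixes f :: "real \<Rightarrow> ennreal" and h :: "nat \<Rightarrow> real \<Rightarrow> real \<Rightarrow> ennreal"
  assumes I: "I \<subseteq> {1..n}" "j \<in> I"
    and [measurable]: "f \<in> borel_measurable borel"
      "\<And>l. l \<in> I \<Longrightarrow> case_prod (h l) \<in> borel_measurable (borel \<Otimes>\<^sub>M borel)"
  shows "(\<integral>\<^sup>+s. f (U j s) * (\<Prod>l\<in>I - {j}. h l (U j s) (U l s)) \<partial>M)
       = (\<integral>\<^sup>+u. f u * (\<Prod>l\<in>I - {j}. \<integral>\<^sup>+y. h l u y \<partial>\<nu>) \<partial>\<nu>)"
proof -
  interpret N: prob_space \<nu> by (rule prob_space_\<nu>)
  interpret P: product_sigma_finite "\<lambda>_. \<nu>" ..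
  have fin: "finite I" using I(1) finite_subset by blast
  have I_eq: "I = insert j (I - {j})" using I(2) by auto
  have U [measurable]: "U l \<in> borel_measurable M" if "l \<in> I" for l using that I(1) by auto
  have "distr M (Pi\<^sub>M I (\<lambda>_. borel)) (\<lambda>s. \<lambda>l\<in>I. U l s) = Pi\<^sub>M I (\<lambda>l. distr M borel (U l))"
    using indep_vars_subset[OF indep I(1)] I U by (subst (asm) indep_vars_iff_distr_eq_PiM') auto
  also have "\<dots> = Pi\<^sub>M I (\<lambda>_. \<nu>)"
    using I by (intro PiM_cong) (auto simp: distr_U)
  finally have distr: "distr M (Pi\<^sub>M I (\<lambda>_. borel)) (\<lambda>s. \<lambda>l\<in>I. U l s) = Pi\<^sub>M I (\<lambda>_. \<nu>)" .
  define \<phi> where "\<phi> x = f (x j) * (\<Prod>l\<in>I - {j}. h l (x j) (x l))" for x :: "nat \<Rightarrow> real"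
  have \<phi>: "\<phi> \<in> borel_measurable (Pi\<^sub>M I (\<lambda>_. borel))"
    unfolding \<phi>_def using I(2) by measurable
  have sets_eq: "sets (Pi\<^sub>M I (\<lambda>_. \<nu>)) = sets (Pi\<^sub>M I (\<lambda>_. borel))"
    by (intro sets_PiM_cong) auto
  have "(\<integral>\<^sup>+s. f (U j s) * (\<Prod>l\<in>I - {j}. h l (U j s) (U l s)) \<partial>M)
      = (\<integral>\<^sup>+s. \<phi> (\<lambda>l\<in>I. U l s) \<partial>M)"
    using I(2) by (intro nn_integral_cong) (auto simp: \<phi>_def intro!: prod.cong)
  also have "\<dots> = (\<integral>\<^sup>+x. \<phi> x \<partial>Pi\<^sub>M I (\<lambda>_. \<nu>))"
    unfolding distr[symmetric] using \<phi> by (subst nn_integral_distr) auto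
  also have "\<dots> = (\<integral>\<^sup>+u. \<integral>\<^sup>+x. \<phi> (x(j := u)) \<partial>Pi\<^sub>M (I - {j}) (\<lambda>_. \<nu>) \<partial>\<nu>)"
    using P.product_nn_integral_insert_rev[of "I - {j}" j \<phi>] fin \<phi> I_eq sets_eq
    by (simp add: measurable_cong_sets[OF sets_eq refl])
  also have "\<dots> = (\<integral>\<^sup>+u. \<integral>\<^sup>+x. f u * (\<Prod>l\<in>I - {j}. h l u (x l)) \<partial>Pi\<^sub>M (I - {j}) (\<lambda>_. \<nu>) \<partial>\<nu>)"
    by (intro nn_integral_cong) (auto simp: \<phi>_def intro!: arg_cong2[where f = "(*)"] prod.cong)
  also have "\<dots> = (\<integral>\<^sup>+u. f u * (\<Prod>l\<in>I - {j}. \<integral>\<^sup>+y. h l u y \<partial>\<nu>) \<partial>\<nu>)"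
  proof (intro nn_integral_cong)
    fix u
    have [measurable]: "h l u \<in> borel_measurable \<nu>" if "l \<in> I" for l
      using that by (simp add: measurable_cong_sets[OF sets_uniform_measure refl]) measurable
    show "(\<integral>\<^sup>+x. f u * (\<Prod>l\<in>I - {j}. h l u (x l)) \<partial>Pi\<^sub>M (I - {j}) (\<lambda>_. \<nu>))
        = f u * (\<Prod>l\<in>I - {j}. \<integral>\<^sup>+y. h l u y \<partial>\<nu>)"
      using fin by (subst nn_integral_cmult, measurable) (subst P.product_nn_integral_prod, auto)
  qed
  finally show ?thesis .
qed

lemma AE_neq: "i \<in> {1..n} \<Longrightarrow> AE s in M. U i s \<noteq> v"
proof -
  assume i: "i \<in> {1..n}"
  have "AE x in lborel. x \<noteq> v"
    by (rule AE_lborel_singleton)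
  then have "AE x in \<nu>. x \<noteq> v"
    by (intro AE_uniform_measureI) auto
  then have "AE x in distr M borel (U i). x \<noteq> v"
    by (simp only: distr_U[OF i])
  then show ?thesis
    using i by (subst (asm) AE_distr_iff) auto
qed

lemma AE_distinct:
  assumes "i \<in> {1..n}" "j \<in> {1..n}" "i \<noteq> j"
  shows "AE s in M. U i s \<noteq> U j s"
proof -
  have "(\<integral>\<^sup>+s. 1 * (\<Prod>l\<in>{i, j} - {j}. (if U j s = U l s then 1 else 0)) \<partial>M)
      = (\<integral>\<^sup>+u. 1 * (\<Prod>l\<in>{i, j} - {j}. \<integral>\<^sup>+y. (if u = y then 1 else 0) \<partial>\<nu>) \<partial>\<nu>)"
    using assms by (intro nn_integral_prod_others) auto
  also have "\<dots> = (\<integral>\<^sup>+u. 0 \<partial>\<nu>)"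
  proof (intro nn_integral_cong)
    fix u
    have "AE y in \<nu>. y \<noteq> u"
      using AE_lborel_singleton[of u] by (intro AE_uniform_measureI) auto
    then have "(\<integral>\<^sup>+y. (if u = y then 1 else 0) \<partial>\<nu>) = (\<integral>\<^sup>+y. 0 \<partial>\<nu>)"
      by (intro nn_integral_cong_AE) auto
    then show "1 * (\<Prod>l\<in>{i, j} - {j}. \<integral>\<^sup>+y. (if u = y then 1 else 0) \<partial>\<nu>) = 0"
      using assms(3) by (auto intro!: prod_zero bexI[of _ i])
  qed
  finally have "(\<integral>\<^sup>+s. (if U j s = U i s then 1 else 0) \<partial>M) = 0"
    using assms(3) by (simp add: insert_Diff_if)
  then have "AE s in M. (if U j s = U i s then 1 else 0 :: ennreal) = 0"
    using assms by (subst (asm) nn_integral_0_iff_AE) auto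
  then show ?thesis
    by eventually_elim (auto split: if_splits)
qed

lemma nn_integral_\<nu>_interval:
  assumes "0 \<le> a" "a \<le> b" "b \<le> 1"
  shows "(\<integral>\<^sup>+y. (if a < y \<and> y < b then 1 else 0) \<partial>\<nu>) = ennreal (b - a)"
proof -
  have "(\<integral>\<^sup>+y. (if a < y \<and> y < b then 1 else 0) \<partial>\<nu>) = (\<integral>\<^sup>+y. indicator {a<..<b} y \<partial>\<nu>)"
    by (intro nn_integral_cong) (auto simp: indicator_def)
  also have "\<dots> = emeasure \<nu> {a<..<b}"
    by simp
  also have "\<dots> = emeasure lborel ({0..1} \<inter> {a<..<b})"
    by (subst emeasure_uniform_measure) (auto simp: divide_ennreal_def)
  also have "{0..1} \<inter> {a<..<b} = {a<..<b}"
    using assms by auto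
  finally show ?thesis using assms by simp
qed

lemma AE_\<nu>: "AE u in \<nu>. 0 < u \<and> u < 1"
proof -
  have "AE u in lborel. u \<noteq> (0::real)" "AE u in lborel. u \<noteq> (1::real)"
    by (auto intro: AE_lborel_singleton)
  then show ?thesis by (intro AE_uniform_measureI) (auto elim!: AE_mp)
qed

lemma AE_U: "j \<in> {1..n} \<Longrightarrow> AE s in M. 0 < U j s \<and> U j s < 1"
proof -
  assume j: "j \<in> {1..n}"
  have "AE x in distr M borel (U j). 0 < x \<and> x < 1"
    using AE_\<nu> by (simp only: distr_U[OF j])
  then show ?thesis
    using j by (subst (asm) AE_distr_iff) auto
qed

lemma prob_all_less:
  assumes "I \<subseteq> {1..n}" "j \<in> I" "v \<in> {0..1}"
  shows "(\<integral>\<^sup>+s. (if \<forall>l\<in>I. U l s < v then 1 else 0) \<partial>M) = ennreal (v ^ card I)"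
proof -
  have fin: "finite I" using assms(1) finite_subset by blast
  have pos: "AE s in M. \<forall>l\<in>I. 0 < U l s"
    using AE_U assms(1) fin by (intro AE_finite_allI) auto
  \<comment> \<open>The extra condition \<open>0 < U l s\<close> holds almost surely; it turns every
    factor into an open interval of known mass.\<close>
  have "(\<integral>\<^sup>+s. (if \<forall>l\<in>I. U l s < v then 1 else 0) \<partial>M)
      = (\<integral>\<^sup>+s. (if 0 < U j s \<and> U j s < v then 1 else 0)
          * (\<Prod>l\<in>I - {j}. if 0 < U l s \<and> U l s < v then 1 else 0) \<partial>M)"
    using pos
  proof (intro nn_integral_cong_AE, eventually_elim)
    case (elim s)
    have "(if 0 < U j s \<and> U j s < v then 1 else 0) * (\<Prod>l\<in>I - {j}. if 0 < U l s \<and> U l s < v then 1 else 0)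
        = (\<Prod>l\<in>I. if 0 < U l s \<and> U l s < v then 1 else 0 :: ennreal)"
      using fin assms(2) by (simp add: prod.remove)
    also have "\<dots> = (if \<forall>l\<in>I. U l s < v then 1 else 0)"
      using elim fin by auto
    finally show ?case by simp
  qed
  also have "\<dots> = (\<integral>\<^sup>+u. (if 0 < u \<and> u < v then 1 else 0)
      * (\<Prod>l\<in>I - {j}. \<integral>\<^sup>+y. (if 0 < y \<and> y < v then 1 else 0) \<partial>\<nu>) \<partial>\<nu>)"
    using assms
    by (intro nn_integral_prod_others[where h = "\<lambda>_ _ y. if 0 < y \<and> y < v then 1 else 0"
          and f = "\<lambda>u. if 0 < u \<and> u < v then 1 else 0"]) auto
  also have "\<dots> = ennreal v * ennreal v ^ (card I - 1)"
    using assms(2,3) fin by (subst nn_integral_multc) (auto simp: nn_integral_\<nu>_interval)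
  also have "\<dots> = ennreal (v ^ card I)"
    using assms(2,3) fin by (cases "card I") (auto simp: ennreal_power ennreal_mult)
  finally show ?thesis .
qed

text \<open>
  The event that exactly \<open>m\<close> of the others lie above \<open>U j\<close> is split according to the set \<open>S\<close> of
  these indices; by symmetry each choice contributes the same amount.
\<close>

lemma nn_integral_rank:
  assumes I: "I \<subseteq> {1..n}" "j \<in> I" and v: "v \<in> {0..1}"
    and g [measurable]: "g \<in> borel_measurable borel" and g_nonneg: "\<And>u. 0 \<le> g u"
  shows "(\<integral>\<^sup>+s. ennreal (g (U j s)) *
            (if (\<forall>l\<in>I. U l s < v) \<and> card {l \<in> I. U j s < U l s} = m then 1 else 0) \<partial>M)
       = of_nat ((card I - 1) choose m)
         * (\<integral>\<^sup>+u. ennreal (g u * (v - u) ^ m * u ^ (card I - 1 - m)) * indicator {0..v} u \<partial>lborel)"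
proof -
  have fin: "finite I" using I(1) finite_subset by blast
  let ?J = "I - {j}"
  let ?\<S> = "{S. S \<subseteq> ?J \<and> card S = m}"
  have fin_S: "finite ?\<S>" using fin by auto
  define f where "f u = ennreal (g u) * (if 0 < u \<and> u < v then 1 else 0)" for u
  \<comment> \<open>Given \<open>U j = u\<close>, an index in S has to fall into (u,v), with mass
    \<open>v - u\<close>, and any other into (0,u), with mass u. These masses become the two powers
    in the integrand.\<close>
  define h :: "nat set \<Rightarrow> nat \<Rightarrow> real \<Rightarrow> real \<Rightarrow> ennreal" where
    "h S l u y = (if l \<in> S then if u < y \<and> y < v then 1 else 0 else if 0 < y \<and> y < u then 1 else 0)" for S l u y
  have U [measurable]: "U l \<in> borel_measurable M" if "l \<in> I" for l
    using I that by auto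
  have f [measurable]: "f \<in> borel_measurable borel"
    unfolding f_def by measurable
  have h [measurable]: "case_prod (h S l) \<in> borel_measurable (borel \<Otimes>\<^sub>M borel)" for S l
    unfolding h_def by measurable
  have pos: "AE s in M. \<forall>l\<in>I. 0 < U l s"
    using AE_U I(1) fin by (intro AE_finite_allI) auto
  have dist: "AE s in M. \<forall>l\<in>?J. U l s \<noteq> U j s"
    using I fin by (intro AE_finite_allI AE_distinct) auto
  have "(\<integral>\<^sup>+s. ennreal (g (U j s)) *
            (if (\<forall>l\<in>I. U l s < v) \<and> card {l \<in> I. U j s < U l s} = m then 1 else 0) \<partial>M)
      = (\<integral>\<^sup>+s. (\<Sum>S\<in>?\<S>. f (U j s) * (\<Prod>l\<in>?J. h S l (U j s) (U l s))) \<partial>M)"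
    using pos dist
  proof (intro nn_integral_cong_AE, eventually_elim)
    case (elim s)
    define A where "A = {l \<in> I. U j s < U l s}"
    have A: "A \<subseteq> ?J" by (auto simp: A_def)
    \<comment> \<open>Off ties, the product vanishes unless S is exactly the set of indices above
      \<open>U j s\<close>, so the sum over all S has at most one nonzero term.\<close>
    have prod: "(\<Prod>l\<in>?J. h S l (U j s) (U l s)) = (if S = A \<and> (\<forall>l\<in>A. U l s < v) then 1 else 0)"
      if "S \<subseteq> ?J" for S
    proof -
      have "(\<Prod>l\<in>?J. h S l (U j s) (U l s)) = (\<Prod>l\<in>?J. if (l \<in> S \<longleftrightarrow> l \<in> A) \<and> (l \<in> A \<longrightarrow> U l s < v) then 1 else 0)"
        using elim by (intro prod.cong) (auto simp: h_def A_def)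
      also have "\<dots> = (if \<forall>l\<in>?J. (l \<in> S \<longleftrightarrow> l \<in> A) \<and> (l \<in> A \<longrightarrow> U l s < v) then 1 else 0)"
        using fin by auto
      also have "(\<forall>l\<in>?J. (l \<in> S \<longleftrightarrow> l \<in> A) \<and> (l \<in> A \<longrightarrow> U l s < v)) \<longleftrightarrow> S = A \<and> (\<forall>l\<in>A. U l s < v)"
        using that A by blast
      finally show ?thesis .
    qed
    have all: "(\<forall>l\<in>I. U l s < v) \<longleftrightarrow> U j s < v \<and> (\<forall>l\<in>A. U l s < v)"
      using I(2) unfolding A_def by force
    have "(\<Sum>S\<in>?\<S>. f (U j s) * (\<Prod>l\<in>?J. h S l (U j s) (U l s)))
        = (\<Sum>S\<in>?\<S>. if S = A then f (U j s) * (if \<forall>l\<in>A. U l s < v then 1 else 0) else 0)"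
      by (intro sum.cong) (auto simp: prod)
    also have "\<dots> = (if card A = m then f (U j s) * (if \<forall>l\<in>A. U l s < v then 1 else 0) else 0)"
      using fin_S A by (subst sum.delta) auto
    also have "\<dots> = ennreal (g (U j s)) * (if (\<forall>l\<in>I. U l s < v) \<and> card A = m then 1 else 0)"
      using elim I(2) by (auto simp: all f_def)
    finally show ?case by (simp add: A_def)
  qed
  also have "\<dots> = (\<Sum>S\<in>?\<S>. \<integral>\<^sup>+s. f (U j s) * (\<Prod>l\<in>?J. h S l (U j s) (U l s)) \<partial>M)"
    using I(2) by (intro nn_integral_sum) measurable
  also have "\<dots> = (\<Sum>S\<in>?\<S>. \<integral>\<^sup>+u. f u * (\<Prod>l\<in>?J. \<integral>\<^sup>+y. h S l u y \<partial>\<nu>) \<partial>\<nu>)"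
    by (rule sum.cong[OF refl], rule nn_integral_prod_others[OF I f h])
  also have "\<dots> = (\<Sum>S\<in>?\<S>. \<integral>\<^sup>+u. ennreal (g u * (v - u) ^ m * u ^ (card I - 1 - m)) * indicator {0..v} u \<partial>\<nu>)"
  proof (intro sum.cong refl nn_integral_cong_AE)
    fix S assume "S \<in> ?\<S>"
    then have S: "S \<subseteq> ?J" "card S = m" "finite S" "card (?J - S) = card I - 1 - m"
      using fin I(2) by (auto simp: card_Diff_subset finite_subset)
    have "AE u in \<nu>. u \<noteq> v"
      using AE_lborel_singleton[of v] by (intro AE_uniform_measureI) auto
    then show "AE u in \<nu>. f u * (\<Prod>l\<in>?J. \<integral>\<^sup>+y. h S l u y \<partial>\<nu>)
        = ennreal (g u * (v - u) ^ m * u ^ (card I - 1 - m)) * indicator {0..v} u"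
      using AE_\<nu>
    proof eventually_elim
      case (elim u)
      show ?case
      proof (cases "u < v")
        case True
        have "(\<Prod>l\<in>?J. \<integral>\<^sup>+y. h S l u y \<partial>\<nu>) = (\<Prod>l\<in>?J. if l \<in> S then ennreal (v - u) else ennreal u)"
          using True elim v
          by (intro prod.cong) (auto simp: h_def nn_integral_\<nu>_interval)
        also have "\<dots> = ennreal (v - u) ^ m * ennreal u ^ (card I - 1 - m)"
          using fin S by (simp add: prod.If_cases Int_absorb1 flip: Diff_eq)
        finally show ?thesis
          using True elim g_nonneg[of u]
          by (simp add: f_def ennreal_mult ennreal_power mult_ac)
      next
        case False
        then show ?thesis using elim by (simp add: f_def)
      qed
    qed
  qed
  also have "\<dots> = of_nat ((card I - 1) choose m)
      * (\<integral>\<^sup>+u. ennreal (g u * (v - u) ^ m * u ^ (card I - 1 - m)) * indicator {0..v} u \<partial>\<nu>)"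
    using fin I(2) n_subsets[of ?J m] by simp
  also have "(\<integral>\<^sup>+u. ennreal (g u * (v - u) ^ m * u ^ (card I - 1 - m)) * indicator {0..v} u \<partial>\<nu>)
      = (\<integral>\<^sup>+u. ennreal (g u * (v - u) ^ m * u ^ (card I - 1 - m)) * indicator {0..v} u \<partial>lborel)"
    using v by (subst nn_integral_uniform_measure) (auto intro!: nn_integral_cong simp: indicator_def divide_ennreal_def)
  finally show ?thesis .
qed

text \<open>The bid b only has to separate the bids of quantiles below v from those above v, so it
  may lie in a jump of g or beyond its range. When bidder i wins, it is itself above the price
  setter, so the kth highest bid comes from the opponent with exactly \<open>k - 2\<close> other
  opponents above it. Summing \<open>nn_integral_rank\<close> over the \<open>n - 1\<close> possible
  opponents gives the constant.\<close>

lemma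
  fixes g :: "real \<Rightarrow> real" and b v :: real and i k :: nat
  defines "bids \<equiv> \<lambda>s. (\<lambda>j. g (U j s))(i := b)"
  assumes i: "i \<in> {1..n}" and k: "2 \<le> k" "k \<le> n" and v: "v \<in> {0..1}"
    and g: "mono g" "strict_mono_on {0..1} g" "\<And>u. 0 \<le> g u"
    and b: "\<And>u. u \<in> {0..1} \<Longrightarrow> u < v \<Longrightarrow> g u < b" "\<And>u. u \<in> {0..1} \<Longrightarrow> v < u \<Longrightarrow> b < g u"
  shows expected_win_prob: "(\<integral>s. win_prob n i (bids s) \<partial>M) = v ^ (n - 1)"
    and expected_payment: "(\<integral>s. win_prob n i (bids s) * kth_highest_bid n k (bids s) \<partial>M)
      = (real n - 1) * real ((n - 2) choose (k - 2))
        * integral {0..v} (\<lambda>u. g u * (v - u) ^ (k - 2) * u ^ (n - k))"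
proof -
  define I where "I = {1..n} - {i}"
  have I: "finite I" "I \<subseteq> {1..n}" "card I = n - 1" "i \<notin> I" "insert i I = {1..n}"
    using i by (auto simp: I_def)
  have "card I > 0" using I(3) k by simp
  then have I_ne: "I \<noteq> {}" by auto
  define W where "W s \<longleftrightarrow> (\<forall>l\<in>I. U l s < v)" for s
  define rk where "rk j s = card {l \<in> I. U j s < U l s}" for j s
  have g_meas [measurable]: "g \<in> borel_measurable borel"
    using g(1) by (rule borel_measurable_mono)
  have U [measurable]: "U l \<in> borel_measurable M" if "l \<in> I" for l
    using I that by auto
  have bids_meas: "(\<lambda>s. bids s j) \<in> borel_measurable M" if "j \<in> {1..n}" for j
    using that by (cases "j = i") (auto simp: bids_def)
  note win_meas [measurable] = borel_measurable_win_prob[OF i bids_meas]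
  have kth_meas [measurable]: "(\<lambda>s. kth_highest_bid n k (bids s)) \<in> borel_measurable M"
    using k by (intro borel_measurable_kth_highest_bid bids_meas) auto
  have bids_i: "bids s i = b" and bids_l: "l \<in> I \<Longrightarrow> bids s l = g (U l s)" for s l
    using I(4) by (auto simp: bids_def)

  \<comment> \<open>On this event there are no ties, neither with the bid b nor among the
    opponents.\<close>
  have good: "AE s in M. (\<forall>l\<in>I. 0 < U l s \<and> U l s < 1) \<and> (\<forall>l\<in>I. U l s \<noteq> v) \<and> inj_on (\<lambda>l. U l s) I"
  proof (intro AE_conjI)
    show "AE s in M. \<forall>l\<in>I. 0 < U l s \<and> U l s < 1"
      using I by (intro AE_finite_allI AE_U) auto
    show "AE s in M. \<forall>l\<in>I. U l s \<noteq> v"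
      using I by (intro AE_finite_allI AE_neq) auto
    have "AE s in M. j \<noteq> l \<longrightarrow> U j s \<noteq> U l s" if "j \<in> I" "l \<in> I" for j l
    proof (cases "j = l")
      case False
      then have "AE s in M. U j s \<noteq> U l s"
        using that I(2) by (intro AE_distinct) auto
      then show ?thesis by simp
    qed simp
    then have "AE s in M. \<forall>j\<in>I. \<forall>l\<in>I. j \<noteq> l \<longrightarrow> U j s \<noteq> U l s"
      using I by (intro AE_finite_allI) auto
    then show "AE s in M. inj_on (\<lambda>l. U l s) I"
      by eventually_elim (auto simp: inj_on_def)
  qed
  have win: "AE s in M. win_prob n i (bids s) = (if W s then 1 else 0)"
    using good
  proof eventually_elim
    case (elim s)
    show ?case
    proof (cases "W s")
      case True
      then have less: "bids s l < b" if "l \<in> I" for l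
        using that elim b(1) by (auto simp: W_def bids_l)
      have "highest_bidders n (bids s) = {i}"
        unfolding highest_bidders_def I(5)[symmetric] using less by (force simp: bids_i)
      then show ?thesis using True by (simp add: win_prob_def)
    next
      case False
      then obtain l where l: "l \<in> I" "v < U l s"
        using elim by (auto simp: W_def not_less le_less)
      then have "b < bids s l" using b(2) elim by (auto simp: bids_l)
      then have "i \<notin> highest_bidders n (bids s)"
        using l(1) I(2) by (force simp: highest_bidders_def bids_i)
      then show ?thesis using False by (simp add: win_prob_def)
    qed
  qed
  have payment: "AE s in M. win_prob n i (bids s) * kth_highest_bid n k (bids s)
      = (\<Sum>j\<in>I. g (U j s) * (if W s \<and> rk j s = k - 2 then 1 else 0))"
    using good win
  proof eventually_elim
    case (elim s)
    show ?case
    proof (cases "W s")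
      case True
      have bij: "bij_betw (\<lambda>j. rk j s) I {..<card I}"
        unfolding rk_def using I(1) elim by (intro bij_betw_rank) auto
      have "k - 2 \<in> {..<card I}" using I(3) k by auto
      then have "k - 2 \<in> (\<lambda>j. rk j s) ` I"
        using bij_betw_imp_surj_on[OF bij] by simp
      then obtain j where j: "j \<in> I" "rk j s = k - 2"
        by auto
      have uniq: "rk l s = k - 2 \<longleftrightarrow> l = j" if "l \<in> I" for l
        using inj_onD[OF bij_betw_imp_inj_on[OF bij], of l j] j that by auto
      have lt: "g (U j s) < g (U l s) \<longleftrightarrow> U j s < U l s" if "l \<in> I" for l
        using that j(1) elim by (intro strict_mono_on_less[OF g(2)]) (auto intro: less_imp_le)
      \<comment> \<open>The winner i adds one to the \<open>k - 2\<close> opponents above j, hence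
        the \<open>k - 1\<close> required by \<open>kth_highest_bid_eqI\<close>.\<close>
      have "{l \<in> {1..n}. bids s j < bids s l} = insert i {l \<in> I. U j s < U l s}"
        unfolding I(5)[symmetric] using True j(1) elim b(1) lt by (auto simp: bids_i bids_l W_def)
      then have "card {l \<in> {1..n}. bids s j < bids s l} = k - 1"
        using j(2) I(1,4) k by (simp add: rk_def)
      then have "kth_highest_bid n k (bids s) = bids s j"
        using k j(1) I(2) by (intro kth_highest_bid_eqI) auto
      moreover have "(\<Sum>l\<in>I. g (U l s) * (if W s \<and> rk l s = k - 2 then 1 else 0))
          = (\<Sum>l\<in>I. if l = j then g (U l s) else 0)"
        using True uniq by (intro sum.cong) auto
      ultimately show ?thesis
        using True elim j(1) I(1) by (simp add: bids_l)
    qed (use elim in simp)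
  qed

  show "(\<integral>s. win_prob n i (bids s) \<partial>M) = v ^ (n - 1)"
  proof -
    obtain j where "j \<in> I" using I_ne by auto
    have "(\<integral>s. win_prob n i (bids s) \<partial>M) = enn2real (\<integral>\<^sup>+s. ennreal (win_prob n i (bids s)) \<partial>M)"
      using win by (intro integral_eq_nn_integral) (auto elim!: eventually_mono)
    also have "(\<integral>\<^sup>+s. ennreal (win_prob n i (bids s)) \<partial>M) = (\<integral>\<^sup>+s. (if \<forall>l\<in>I. U l s < v then 1 else 0) \<partial>M)"
      using win by (intro nn_integral_cong_AE) (auto elim!: eventually_mono simp: W_def)
    also have "\<dots> = ennreal (v ^ (n - 1))"
      using prob_all_less[OF I(2) \<open>j \<in> I\<close> v] I(3) by simp
    finally show ?thesis using v by simp
  qed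

  let ?f = "\<lambda>u. g u * (v - u) ^ (k - 2) * u ^ (n - k)"
  have f_nonneg: "0 \<le> ?f u" if "u \<in> {0..v}" for u
    using that g(3) by auto
  have f_int: "?f integrable_on {0..v}"
  proof (rule integrable_on_bounded_borel)
    fix u assume u: "u \<in> {0..v}"
    have "g u * (v - u) ^ (k - 2) * u ^ (n - k) \<le> g 1 * 1 * 1"
      using u v g by (intro mult_mono power_le_one) (auto simp: mono_def)
    then show "\<bar>?f u\<bar> \<le> g 1" using f_nonneg[OF u] by simp
  qed simp
  show "(\<integral>s. win_prob n i (bids s) * kth_highest_bid n k (bids s) \<partial>M)
      = (real n - 1) * real ((n - 2) choose (k - 2)) * integral {0..v} ?f"
  proof -
    have rk_meas [measurable]: "Measurable.pred M (\<lambda>s. W s \<and> rk j s = k - 2)" if "j \<in> I" for j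
    proof -
      have "rk j s = (\<Sum>l\<in>I. if U j s < U l s then 1 else 0)" for s
        using I(1) by (simp add: rk_def sum.If_cases Int_def)
      then show ?thesis using that I(1) unfolding W_def by simp
    qed
    have "(\<integral>s. win_prob n i (bids s) * kth_highest_bid n k (bids s) \<partial>M)
        = enn2real (\<integral>\<^sup>+s. ennreal (win_prob n i (bids s) * kth_highest_bid n k (bids s)) \<partial>M)"
      using payment g(3) by (intro integral_eq_nn_integral) (auto elim!: eventually_mono intro!: sum_nonneg)
    also have "(\<integral>\<^sup>+s. ennreal (win_prob n i (bids s) * kth_highest_bid n k (bids s)) \<partial>M)
        = (\<integral>\<^sup>+s. (\<Sum>j\<in>I. ennreal (g (U j s)) * (if W s \<and> rk j s = k - 2 then 1 else 0)) \<partial>M)"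
    proof (intro nn_integral_cong_AE, use payment in eventually_elim)
      case (elim s)
      have "ennreal (\<Sum>j\<in>I. g (U j s) * (if W s \<and> rk j s = k - 2 then 1 else 0))
          = (\<Sum>j\<in>I. ennreal (g (U j s) * (if W s \<and> rk j s = k - 2 then 1 else 0)))"
        using g(3) by (intro sum_ennreal[symmetric]) auto
      also have "\<dots> = (\<Sum>j\<in>I. ennreal (g (U j s)) * (if W s \<and> rk j s = k - 2 then 1 else 0))"
        by (intro sum.cong) auto
      finally show ?case using elim by simp
    qed
    also have "\<dots> = (\<Sum>j\<in>I. \<integral>\<^sup>+s. ennreal (g (U j s)) * (if W s \<and> rk j s = k - 2 then 1 else 0) \<partial>M)"
      by (intro nn_integral_sum) measurable
    also have "\<dots> = (\<Sum>j\<in>I. of_nat ((n - 2) choose (k - 2)) * ennreal (integral {0..v} ?f))"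
    proof (intro sum.cong refl)
      fix j assume j: "j \<in> I"
      have "card I - 1 = n - 2" "card I - 1 - (k - 2) = n - k"
        using I(3) k by auto
      then show "(\<integral>\<^sup>+s. ennreal (g (U j s)) * (if W s \<and> rk j s = k - 2 then 1 else 0) \<partial>M)
          = of_nat ((n - 2) choose (k - 2)) * ennreal (integral {0..v} ?f)"
        using nn_integral_rank[OF I(2) j v g_meas g(3), where m = "k - 2"]
          nn_integral_has_integral_lebesgue'[OF f_nonneg integrable_integral[OF f_int]]
        by (simp add: W_def rk_def)
    qed
    also have "\<dots> = ennreal (real (n - 1) * real ((n - 2) choose (k - 2)) * integral {0..v} ?f)"
      using I(3) by (simp add: ennreal_mult' ennreal_of_nat_eq_real_of_nat mult.assoc)
    finally show ?thesis
      using k integral_nonneg[OF f_int f_nonneg] by (simp add: of_nat_diff)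
  qed
qed

end

section \<open>The auction\<close>

lemma win_prob_cong:
  assumes "i \<in> {1..n}" "\<And>j. j \<in> {1..n} \<Longrightarrow> b j = b' j"
  shows "win_prob n i b = win_prob n i b'"
proof -
  have "highest_bidders n b = highest_bidders n b'"
    using assms(2) by (auto simp: highest_bidders_def)
  then show ?thesis by (simp add: win_prob_def)
qed

lemma kth_highest_bid_cong:
  assumes "\<And>j. j \<in> {1..n} \<Longrightarrow> b j = b' j"
  shows "kth_highest_bid n k b = kth_highest_bid n k b'"
proof -
  have "map b [1..<Suc n] = map b' [1..<Suc n]"
    using assms by (intro map_cong) (auto simp del: upt_Suc)
  then show ?thesis by (simp only: kth_highest_bid_def)
qed

lemma cdf_uniform:
  "cdf (uniform_measure lborel {0..1}) y = max 0 (min 1 (y::real))"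
proof -
  have "measure (uniform_measure lborel {0..1}) {..y} = measure lborel ({0..1} \<inter> {..y})"
    by (simp add: measure_def emeasure_uniform_measure divide_ennreal_def)
  also have "{0..1} \<inter> {..y} = {0..min 1 y}" by auto
  finally show ?thesis
    by (cases "0 \<le> y") (auto simp: cdf_def min_def max_def)
qed

lemma slope_pos:
  assumes "3 \<le> k" "k \<le> n"
  shows "0 < slope n k"
proof -
  have "0 < 1 + real (k - 2) / (2 * real (n - 2))"
    by (intro add_pos_nonneg) auto
  then show ?thesis using slope_ge[OF assms] by (rule less_le_trans)
qed

section \<open>Reduction of the quadratic distribution to uniform quantiles\<close>

locale quadratic_auction = prob_space M for M :: "'a measure" +
  fixes X :: "nat \<Rightarrow> 'a \<Rightarrow> real" and n k :: nat and a \<omega> :: real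
  assumes k: "3 \<le> k" "k \<le> n" and \<omega>: "0 < \<omega>" and a: "0 < a"
    and X_range: "i \<in> {1..n} \<Longrightarrow> s \<in> space M \<Longrightarrow> X i s \<in> {0..\<omega>}"
    and X_indep: "indep_vars (\<lambda>_. borel) X {1..n}"
    and X_cdf: "i \<in> {1..n} \<Longrightarrow> x \<in> {0..\<omega>} \<Longrightarrow> cdf (distr M borel (X i)) x = a * x\<^sup>2 / 2"
begin

lemma measurable_X [measurable]: "i \<in> {1..n} \<Longrightarrow> X i \<in> borel_measurable M"
  using X_indep by (auto simp: indep_vars_def)

lemma cdf_X:
  assumes i: "i \<in> {1..n}"
  shows "cdf (distr M borel (X i)) x = prob {s \<in> space M. X i s \<le> x}"
  using i unfolding cdf_def by (subst measure_distr) (auto intro!: arg_cong[where f = prob])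

text \<open>All values are at most \<omega>, so F(\<omega>) = 1, which fixes a.\<close>

lemma a_eq: "a = 2 / \<omega>\<^sup>2"
proof -
  have one: "1 \<in> {1..n}" using k by auto
  have "{s \<in> space M. X 1 s \<le> \<omega>} = space M"
    using X_range[OF one] by auto
  then have "cdf (distr M borel (X 1)) \<omega> = 1"
    unfolding cdf_X[OF one] by (simp only: prob_space)
  then have "a * \<omega>\<^sup>2 / 2 = 1"
    using X_cdf[OF one, of \<omega>] \<omega> by simp
  then show ?thesis using \<omega> by (simp add: field_simps)
qed

text \<open>This is the probability integral transform, checked on distribution functions: for y in
  [0,1] the event is \<open>X i s \<le> \<omega> * sqrt y\<close>, where F takes the value
  y.\<close>

sublocale U: uniform_values M "\<lambda>i s. (X i s / \<omega>)\<^sup>2" n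
proof
  show "indep_vars (\<lambda>_. borel) (\<lambda>i s. (X i s / \<omega>)\<^sup>2) {1..n}"
    by (rule indep_vars_compose2[OF X_indep]) simp
  fix i assume i: "i \<in> {1..n}"
  have [measurable]: "X i \<in> borel_measurable M" using i by simp
  let ?N = "distr M borel (\<lambda>s. (X i s / \<omega>)\<^sup>2)"
  interpret N: prob_space ?N by (rule prob_space_distr) measurable
  interpret V: prob_space "uniform_measure lborel {0..1::real}"
    by (intro prob_space_uniform_measure) auto
  show "?N = uniform_measure lborel {0..1}"
  proof (rule cdf_unique')
    show "finite_borel_measure ?N" "finite_borel_measure (uniform_measure lborel {0..1::real})"
      by (auto intro!: finite_borel_measure.intro finite_borel_measure_axioms.intro
        N.finite_measure_axioms V.finite_measure_axioms)
    show "cdf ?N = cdf (uniform_measure lborel {0..1})"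
    proof
      fix y
      have N: "cdf ?N y = prob {s \<in> space M. (X i s / \<omega>)\<^sup>2 \<le> y}"
        unfolding cdf_def by (subst measure_distr) (auto intro!: arg_cong[where f = prob])
      consider "y < 0" | "0 \<le> y" "y \<le> 1" | "1 < y" by linarith
      then show "cdf ?N y = cdf (uniform_measure lborel {0..1}) y"
      proof cases
        case 1
        then have empty: "{s \<in> space M. (X i s / \<omega>)\<^sup>2 \<le> y} = {}"
          by (auto simp: not_le intro: less_le_trans[OF _ zero_le_power2])
        show ?thesis using 1 unfolding N cdf_uniform empty by simp
      next
        case 2
        have "(X i s / \<omega>)\<^sup>2 \<le> y \<longleftrightarrow> X i s \<le> \<omega> * sqrt y" if "s \<in> space M" for s
        proof -
          have "(X i s / \<omega>)\<^sup>2 \<le> y \<longleftrightarrow> X i s / \<omega> \<le> sqrt y"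
            using X_range[OF i that] \<omega> 2 real_le_rsqrt sqrt_le_D[of "X i s / \<omega>" y]
            by (metis atLeastAtMost_iff divide_nonneg_pos power_mono real_sqrt_pow2)
          then show ?thesis using \<omega> by (simp add: field_simps)
        qed
        then have "{s \<in> space M. (X i s / \<omega>)\<^sup>2 \<le> y} = {s \<in> space M. X i s \<le> \<omega> * sqrt y}"
          by auto
        moreover have "prob {s \<in> space M. X i s \<le> \<omega> * sqrt y} = y"
          using X_cdf[OF i, of "\<omega> * sqrt y"] \<omega> 2
          by (simp add: cdf_X[OF i] a_eq power_mult_distrib mult_le_cancel_left1)
        ultimately show ?thesis using 2 by (simp add: N cdf_uniform)
      next
        case 3
        have "(X i s / \<omega>)\<^sup>2 \<le> 1" if "s \<in> space M" for s
          using X_range[OF i that] \<omega> by (intro power_le_one) auto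
        then have "{s \<in> space M. (X i s / \<omega>)\<^sup>2 \<le> y} = space M"
          using 3 by force
        with 3 show ?thesis by (simp add: N cdf_uniform prob_space)
      qed
    qed
  qed
qed

definition payment :: "(real \<Rightarrow> real) \<Rightarrow> real \<Rightarrow> real" where
  "payment \<beta> z = (real n - 1) * real ((n - 2) choose (k - 2))
     * integral {0..(z / \<omega>)\<^sup>2} (\<lambda>u. \<beta> (\<omega> * sqrt u) * ((z / \<omega>)\<^sup>2 - u) ^ (k - 2) * u ^ (n - k))"

text \<open>Clamping u to [0,1] extends the bid as a function of the quantile to a monotone function
  on all reals, although nothing is known of \<beta> outside [0,\<omega>]. Borel measurability and
  the countability of its discontinuities follow from this monotonicity.\<close>

lemma sqrt_strict_mono_comp:
  assumes "strict_mono_on {0..\<omega>} \<beta>"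
  shows "mono (\<lambda>u. \<beta> (\<omega> * sqrt (max 0 (min 1 u))))"
    and "strict_mono_on {0..1} (\<lambda>u. \<beta> (\<omega> * sqrt (max 0 (min 1 u))))"
proof -
  have range: "\<omega> * sqrt (max 0 (min 1 u)) \<in> {0..\<omega>}" for u
    using \<omega> by (auto simp: mult_le_cancel_left1)
  show "mono (\<lambda>u. \<beta> (\<omega> * sqrt (max 0 (min 1 u))))"
    using \<omega> by (intro monoI strict_mono_on_leD[OF assms] range mult_left_mono real_sqrt_le_mono max.mono min.mono) auto
  show "strict_mono_on {0..1} (\<lambda>u. \<beta> (\<omega> * sqrt (max 0 (min 1 u))))"
    using \<omega> by (intro strict_mono_onI strict_mono_onD[OF assms] range) auto
qed

text \<open>Only the first summand involves the true value x; \<open>payment\<close> depends on the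
  strategy and the imitated value z alone. This separation is what payoff equivalence rests
  on.\<close>

lemma expected_payoff_eq:
  assumes i: "i \<in> {1..n}" and z: "z \<in> {0..\<omega>}"
    and \<beta>: "strict_mono_on {0..\<omega>} \<beta>" "\<And>x. x \<in> {0..\<omega>} \<Longrightarrow> 0 \<le> \<beta> x"
    and b: "\<And>t. t \<in> {0..\<omega>} \<Longrightarrow> t < z \<Longrightarrow> \<beta> t < b" "\<And>t. t \<in> {0..\<omega>} \<Longrightarrow> z < t \<Longrightarrow> b < \<beta> t"
  shows "expected_payoff M X n k \<beta> i x b = x * (z / \<omega>) ^ (2 * n - 2) - payment \<beta> z"
proof -
  define g where "g u = \<beta> (\<omega> * sqrt (max 0 (min 1 u)))" for u
  let ?v = "(z / \<omega>)\<^sup>2"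
  have v: "?v \<in> {0..1}" using z \<omega> by (auto intro!: power_le_one)
  have range: "\<omega> * sqrt (max 0 (min 1 u)) \<in> {0..\<omega>}" for u
    using \<omega> by (auto simp: mult_le_cancel_left1)
  have sqrt_v: "\<omega> * sqrt ?v = z" using z \<omega> by simp
  have g: "mono g" "strict_mono_on {0..1} g" "0 \<le> g u" for u
    unfolding g_def using sqrt_strict_mono_comp[OF \<beta>(1)] \<beta>(2)[OF range] by auto
  have b': "g u < b" if "u \<in> {0..1}" "u < ?v" for u
    unfolding g_def
  proof (rule b(1)[OF range])
    have "\<omega> * sqrt u < \<omega> * sqrt ?v" using that \<omega> by (simp del: real_sqrt_abs real_sqrt_power)
    then show "\<omega> * sqrt (max 0 (min 1 u)) < z" using that by (simp only: sqrt_v) simp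
  qed
  have b'': "b < g u" if "u \<in> {0..1}" "?v < u" for u
    unfolding g_def
  proof (rule b(2)[OF range])
    have "\<omega> * sqrt ?v < \<omega> * sqrt u" using that \<omega> by (simp del: real_sqrt_abs real_sqrt_power)
    then show "z < \<omega> * sqrt (max 0 (min 1 u))" using that by (simp only: sqrt_v) simp
  qed
  let ?bids = "\<lambda>s. (\<lambda>j. g ((X j s / \<omega>)\<^sup>2))(i := b)"
  have bids: "((\<lambda>j. \<beta> (X j s))(i := b)) j = ?bids s j" if "s \<in> space M" "j \<in> {1..n}" for s j
  proof -
    have "\<omega> * sqrt (max 0 (min 1 ((X j s / \<omega>)\<^sup>2))) = X j s"
      using X_range[OF that(2,1)] \<omega> by (simp add: power_le_one)
    then show ?thesis by (simp add: g_def)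
  qed
  have win: "win_prob n i ((\<lambda>j. \<beta> (X j s))(i := b)) = win_prob n i (?bids s)" if "s \<in> space M" for s
    using i bids[OF that] by (rule win_prob_cong)
  have kth: "kth_highest_bid n k ((\<lambda>j. \<beta> (X j s))(i := b)) = kth_highest_bid n k (?bids s)" if "s \<in> space M" for s
    using bids[OF that] by (rule kth_highest_bid_cong)
  have "integral {0..?v} (\<lambda>u. g u * (?v - u) ^ (k - 2) * u ^ (n - k))
      = integral {0..?v} (\<lambda>u. \<beta> (\<omega> * sqrt u) * (?v - u) ^ (k - 2) * u ^ (n - k))"
    using v by (intro integral_cong) (auto simp: g_def)
  moreover have "?v ^ (n - 1) = (z / \<omega>) ^ (2 * n - 2)"
    by (simp add: power_mult[symmetric] diff_mult_distrib2)
  moreover have "2 \<le> k" using k by simp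
  ultimately show ?thesis
    using U.expected_win_prob[OF i _ k(2) v g b' b''] U.expected_payment[OF i _ k(2) v g b' b'']
    by (simp add: expected_payoff_def Let_def win kth payment_def cong: Bochner_Integration.integral_cong)
qed

text \<open>The result is the Stieltjes integral of t against (t/\<omega>)^(2n-2) over [0,z], which
  no longer involves k. With \<open>p = n - k + 1/2\<close> the Beta integral has
  \<open>p + (k - 2) = n - 3/2\<close>, so its binomial is the numerator of
  \<open>slope\<close>.\<close>

lemma payment_slope:
  assumes z: "z \<in> {0..\<omega>}"
  shows "payment (\<lambda>x. slope n k * x) z
    = \<omega> * (real (2 * n - 2) / (real (2 * n - 2) + 1) * (z / \<omega>) ^ (2 * n - 2 + 1))"
proof -
  let ?v = "(z / \<omega>)\<^sup>2" and ?p = "real (n - k) + 1 / 2"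
  define c where "c = slope n k"
  define G where "G = (real n - 3 / 2) gchoose (k - 2)"
  have pk: "?p + real (k - 2) = real n - 3 / 2" "?p + real (k - 2) + 1 = real n - 1 / 2"
    using k by (auto simp: of_nat_diff)
  have G: "G \<noteq> 0"
  proof -
    have "slope n k \<noteq> 0"
      using slope_pos[OF k] by simp
    then show ?thesis by (auto simp: slope_def G_def)
  qed
  have cG: "real ((n - 2) choose (k - 2)) * c = G"
    using k by (simp add: c_def slope_def G_def)
  have "((\<lambda>u. c * \<omega> * (u powr ?p * (?v - u) ^ (k - 2))) has_integral
      c * \<omega> * (?v powr (real n - 1 / 2) / ((real n - 1 / 2) * G))) {0..?v}"
    using has_integral_powr_mult_diff_power[of ?p ?v "k - 2"]
    by (intro has_integral_mult_right) (simp add: pk G_def)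
  also have "?v powr (real n - 1 / 2) = (z / \<omega>) ^ (2 * n - 1)"
  proof (cases "z = 0")
    case False
    then have "0 < z / \<omega>" using z \<omega> by simp
    then have "?v powr (real n - 1 / 2) = (z / \<omega>) powr (2 * (real n - 1 / 2))"
      by (simp add: powr_powr flip: powr_numeral)
    also have "2 * (real n - 1 / 2) = real (2 * n - 1)" using k by (simp add: of_nat_diff)
    finally show ?thesis using \<open>0 < z / \<omega>\<close> by (simp only: powr_realpow)
  qed (use k in auto)
  finally have "((\<lambda>u. c * (\<omega> * sqrt u) * (?v - u) ^ (k - 2) * u ^ (n - k)) has_integral
      c * \<omega> * ((z / \<omega>) ^ (2 * n - 1) / ((real n - 1 / 2) * G))) {0..?v}"
  proof (rule has_integral_eq[rotated])
    fix u assume "u \<in> {0..?v}"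
    then have "u powr ?p = u ^ (n - k) * sqrt u"
      by (cases "u = 0") (auto simp: powr_add powr_realpow powr_half_sqrt)
    then show "c * \<omega> * (u powr ?p * (?v - u) ^ (k - 2)) = c * (\<omega> * sqrt u) * (?v - u) ^ (k - 2) * u ^ (n - k)"
      by simp
  qed
  then have "payment (\<lambda>x. c * x) z
      = (real n - 1) * real ((n - 2) choose (k - 2)) * (c * \<omega> * ((z / \<omega>) ^ (2 * n - 1) / ((real n - 1 / 2) * G)))"
    unfolding payment_def by (simp only: integral_unique)
  also have "\<dots> = (real n - 1) * (real ((n - 2) choose (k - 2)) * c) * \<omega> * ((z / \<omega>) ^ (2 * n - 1) / ((real n - 1 / 2) * G))"
    by (simp only: mult_ac)
  also have "\<dots> = \<omega> * ((real n - 1) / (real n - 1 / 2) * (z / \<omega>) ^ (2 * n - 1))"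
    using G by (simp add: cG)
  also have "(real n - 1) / (real n - 1 / 2) = real (2 * n - 2) / (real (2 * n - 2) + 1)"
    using k by (simp add: of_nat_diff divide_simps) (simp add: algebra_simps)
  also have "2 * n - 1 = 2 * n - 2 + 1" using k by simp
  finally show ?thesis by (simp add: c_def)
qed


lemma linear_strategy:
  assumes "0 < (c::real)"
  shows "strict_mono_on {0..\<omega>} (\<lambda>x. c * x)" "x \<in> {0..\<omega>} \<Longrightarrow> 0 \<le> c * x"
  using assms by (auto intro!: strict_mono_onI)

lemma equilibrium_slope:
  "symmetric_increasing_equilibrium M X n k \<omega> (\<lambda>x. slope n k * x)"
  unfolding symmetric_increasing_equilibrium_def symmetric_equilibrium_def
proof (intro conjI ballI allI impI)
  define c where "c = slope n k"
  have c: "0 < c" unfolding c_def by (rule slope_pos[OF k])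
  note lin = linear_strategy[OF c]
  show "strict_mono_on {0..\<omega>} (\<lambda>x. slope n k * x)"
    using lin(1) by (simp add: c_def)
  show "0 \<le> slope n k * x" if "x \<in> {0..\<omega>}" for x
    using lin(2)[OF that] by (simp add: c_def)
  fix i x b assume i: "i \<in> {1..n}" and x: "x \<in> {0..\<omega>}" and b: "(0::real) \<le> b"
  define N where "N = 2 * n - 2"
  let ?P = "\<lambda>z. x / \<omega> * (z / \<omega>) ^ N - real N / (real N + 1) * (z / \<omega>) ^ (N + 1)"
  have payoff: "expected_payoff M X n k (\<lambda>x. c * x) i x b' = \<omega> * ?P z"
    if "z \<in> {0..\<omega>}" "\<And>t. t \<in> {0..\<omega>} \<Longrightarrow> t < z \<Longrightarrow> c * t < b'"
      "\<And>t. t \<in> {0..\<omega>} \<Longrightarrow> z < t \<Longrightarrow> b' < c * t" for z b'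
  proof -
    have "expected_payoff M X n k (\<lambda>x. c * x) i x b' = x * (z / \<omega>) ^ N - payment (\<lambda>x. c * x) z"
      unfolding N_def by (rule expected_payoff_eq[OF i that(1) lin that(2,3)])
    then show ?thesis
      unfolding c_def payment_slope[OF that(1)] N_def[symmetric] using \<omega> by (simp add: algebra_simps)
  qed
  \<comment> \<open>Every nonnegative bid imitates some value. A bid above
    \<open>c * \<omega>\<close> imitates \<omega>: it wins almost surely, at a price set by the
    opponents.\<close>
  define z where "z = min \<omega> (b / c)"
  have z: "z \<in> {0..\<omega>}" using b c \<omega> by (auto simp: z_def)
  have "expected_payoff M X n k (\<lambda>x. c * x) i x b = \<omega> * ?P z"
    using c by (intro payoff z) (auto simp: z_def min_less_iff_disj field_simps)
  also have "\<dots> \<le> \<omega> * ?P x"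
    using x z \<omega> by (intro mult_left_mono power_tangent_le) auto
  also have "\<dots> = expected_payoff M X n k (\<lambda>x. c * x) i x (c * x)"
    using c by (intro payoff[symmetric] x) auto
  finally show "expected_payoff M X n k (\<lambda>x. slope n k * x) i x b
      \<le> expected_payoff M X n k (\<lambda>x. slope n k * x) i x (slope n k * x)"
    by (simp only: c_def)
qed

section \<open>Uniqueness: incentive constraints, payoff equivalence, recovery of the
  strategy\<close>

lemma equilibrium_payment_ineq:
  assumes "symmetric_increasing_equilibrium M X n k \<omega> \<beta>" and x: "x \<in> {0..\<omega>}" and z: "z \<in> {0..\<omega>}"
  shows "x * ((z / \<omega>) ^ (2 * n - 2) - (x / \<omega>) ^ (2 * n - 2)) \<le> payment \<beta> z - payment \<beta> x"
proof -
  have \<beta>: "strict_mono_on {0..\<omega>} \<beta>" "\<And>x. x \<in> {0..\<omega>} \<Longrightarrow> 0 \<le> \<beta> x"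
    and eq: "\<And>i x b. i \<in> {1..n} \<Longrightarrow> x \<in> {0..\<omega>} \<Longrightarrow> 0 \<le> b \<Longrightarrow>
      expected_payoff M X n k \<beta> i x b \<le> expected_payoff M X n k \<beta> i x (\<beta> x)"
    using assms(1) by (auto simp: symmetric_increasing_equilibrium_def symmetric_equilibrium_def)
  have one: "1 \<in> {1..n}" using k by auto
  have payoff: "expected_payoff M X n k \<beta> 1 x (\<beta> y) = x * (y / \<omega>) ^ (2 * n - 2) - payment \<beta> y" if "y \<in> {0..\<omega>}" for y
    by (rule expected_payoff_eq[OF one that \<beta>]) (use that strict_mono_onD[OF \<beta>(1)] in auto)
  then show ?thesis
    using eq[OF one x \<beta>(2)[OF z]] unfolding payoff[OF x] payoff[OF z] by (simp add: algebra_simps)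
qed

text \<open>
  The equilibrium conditions at \<open>x\<close> and \<open>z\<close> confine the increment of the payment between \<open>x\<close> and \<open>z\<close>
  times the increment of the winning probability, so two payment functions differ by a function with
  derivative zero (payoff equivalence).
\<close>

lemma equilibrium_payment_unique:
  assumes "symmetric_increasing_equilibrium M X n k \<omega> \<beta>"
    and "symmetric_increasing_equilibrium M X n k \<omega> \<gamma>" and z: "z \<in> {0..\<omega>}"
  shows "payment \<beta> z = payment \<gamma> z"
proof -
  define G where "G x = (x / \<omega>) ^ (2 * n - 2)" for x
  define D where "D x = payment \<beta> x - payment \<gamma> x" for x
  have bound: "\<bar>D y - D x\<bar> \<le> \<bar>(y - x) * (G y - G x)\<bar>" if "x \<in> {0..\<omega>}" "y \<in> {0..\<omega>}" for x y
  proof -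
    have "D y - D x \<le> (y - x) * (G y - G x)" "- ((y - x) * (G y - G x)) \<le> D y - D x"
      using equilibrium_payment_ineq[OF assms(1) that] equilibrium_payment_ineq[OF assms(1) that(2,1)]
        equilibrium_payment_ineq[OF assms(2) that] equilibrium_payment_ineq[OF assms(2) that(2,1)]
      unfolding D_def G_def by (simp_all add: algebra_simps)
    then show ?thesis by linarith
  qed
  have "(D has_field_derivative 0) (at x within {0..\<omega>})" if x: "x \<in> {0..\<omega>}" for x
    unfolding has_field_derivative_iff
  proof (rule Lim_null_comparison)
    \<comment> \<open>Division cancels the factor \<open>y - x\<close> of the bound; what is left
      tends to 0 by continuity of G.\<close>
    have "\<bar>(D y - D x) / (y - x)\<bar> \<le> \<bar>G y - G x\<bar>" if "y \<noteq> x" "y \<in> {0..\<omega>}" for y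
      using bound[OF x that(2)] that(1) by (simp add: abs_mult pos_divide_le_eq mult.commute)
    then show "\<forall>\<^sub>F y in at x within {0..\<omega>}. norm ((D y - D x) / (y - x)) \<le> \<bar>G y - G x\<bar>"
      unfolding eventually_at_filter by (intro always_eventually) simp
    have "continuous_on {0..\<omega>} (\<lambda>y. \<bar>G y - G x\<bar>)"
      unfolding G_def by (intro continuous_intros) (use \<omega> in auto)
    then have "((\<lambda>y. \<bar>G y - G x\<bar>) \<longlongrightarrow> \<bar>G x - G x\<bar>) (at x within {0..\<omega>})"
      unfolding continuous_on_def using x by (rule bspec)
    then show "((\<lambda>y. \<bar>G y - G x\<bar>) \<longlongrightarrow> 0) (at x within {0..\<omega>})"
      by simp
  qed
  then obtain C where "\<And>x. x \<in> {0..\<omega>} \<Longrightarrow> D x = C"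
    using has_field_derivative_zero_constant[of "{0..\<omega>}" D] by auto
  \<comment> \<open>At value 0 both payments are integrals over a single point, so the constant is
    0.\<close>
  then have "D z = D 0" using z \<omega> by auto
  then show ?thesis by (simp add: D_def payment_def)
qed

text \<open>Volterra inversion recovers \<beta> only at quantiles where it is continuous. The
  exceptions are countable, so every interval contains a point of agreement.\<close>

lemma equilibrium_dense:
  assumes \<beta>: "symmetric_increasing_equilibrium M X n k \<omega> \<beta>" and xy: "0 \<le> x" "x < y" "y \<le> \<omega>"
  obtains t where "x < t" "t < y" "\<beta> t = slope n k * t"
proof -
  define c where "c = slope n k"
  define g where "g u = \<beta> (\<omega> * sqrt (max 0 (min 1 u)))" for u
  define f where "f u = (g u - c * (\<omega> * sqrt u)) * u ^ (n - k)" for u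
  define D where "D = {u. \<not> isCont g u}"
  have mono: "strict_mono_on {0..\<omega>} \<beta>"
    using \<beta> by (simp add: symmetric_increasing_equilibrium_def)
  have g: "mono g" unfolding g_def by (rule sqrt_strict_mono_comp(1)[OF mono])
  have [measurable]: "g \<in> borel_measurable borel" using g by (rule borel_measurable_mono)
  have g_bd: "\<bar>g u\<bar> \<le> max \<bar>g 0\<bar> \<bar>g 1\<bar>" if "u \<in> {0..1}" for u
    using monoD[OF g, of 0 u] monoD[OF g, of u 1] that by auto
  have prod_int: "(\<lambda>u. g u * (w - u) ^ m * u ^ j) integrable_on {0..v}" if "v \<in> {0..1}" "w \<in> {0..1}" for w m j v
  proof (rule integrable_on_bounded_borel)
    fix u assume "u \<in> {0..v}"
    then have u: "u \<in> {0..1}" using that by auto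
    have "\<bar>w - u\<bar> ^ m \<le> 1" "\<bar>u\<bar> ^ j \<le> 1" using u that by (auto intro!: power_le_one)
    then have "\<bar>g u\<bar> * \<bar>w - u\<bar> ^ m * \<bar>u\<bar> ^ j \<le> max \<bar>g 0\<bar> \<bar>g 1\<bar> * 1 * 1"
      by (intro mult_mono g_bd u) auto
    then show "\<bar>g u * (w - u) ^ m * u ^ j\<bar> \<le> max \<bar>g 0\<bar> \<bar>g 1\<bar>"
      by (simp add: abs_mult power_abs)
  qed simp
  have sqrt_int: "(\<lambda>u. c * (\<omega> * sqrt u) * (w - u) ^ m * u ^ j) integrable_on {0..v}" for w m j v
    by (intro integrable_continuous_real continuous_intros)
  have f_zero: "f v = 0" if "v \<in> {0<..<1} - D" for v
  proof (rule eq_0_if_integral_mult_diff_power_eq_0[OF _ _ _ _ that, where m = "k - 2"])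
    show "(\<lambda>u. u ^ j * f u) integrable_on {0..1}" for j
      using integrable_diff[OF prod_int[of 1 1 0 "n - k + j"] sqrt_int[of 1 0 "n - k + j" 1]]
      by (simp add: f_def algebra_simps power_add)
    show "countable D" unfolding D_def by (rule mono_ctble_discont[OF g])
    show "isCont f u" if "u \<in> {0<..<1} - D" for u
      unfolding f_def using that by (intro continuous_intros) (auto simp: D_def)
    \<comment> \<open>Up to a nonzero factor this integral is the difference between the payments
      under \<beta> and under the linear equilibrium, at the value z with quantile v.\<close>
    show "integral {0..v} (\<lambda>u. f u * (v - u) ^ (k - 2)) = 0" if v: "v \<in> {0..1}" for v
    proof -
      define z where "z = \<omega> * sqrt v"
      have z: "z \<in> {0..\<omega>}" "(z / \<omega>)\<^sup>2 = v"
        using v \<omega> by (auto simp: z_def mult_le_cancel_left1)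
      have K: "(real n - 1) * real ((n - 2) choose (k - 2)) \<noteq> 0"
        using k by auto
      have "integral {0..v} (\<lambda>u. f u * (v - u) ^ (k - 2))
          = integral {0..v} (\<lambda>u. g u * (v - u) ^ (k - 2) * u ^ (n - k) - c * (\<omega> * sqrt u) * (v - u) ^ (k - 2) * u ^ (n - k))"
        by (intro integral_cong) (simp add: f_def algebra_simps)
      also have "\<dots> = integral {0..v} (\<lambda>u. g u * (v - u) ^ (k - 2) * u ^ (n - k))
          - integral {0..v} (\<lambda>u. c * (\<omega> * sqrt u) * (v - u) ^ (k - 2) * u ^ (n - k))"
        by (intro integral_diff prod_int sqrt_int v)
      also have "integral {0..v} (\<lambda>u. g u * (v - u) ^ (k - 2) * u ^ (n - k))
          = integral {0..v} (\<lambda>u. \<beta> (\<omega> * sqrt u) * (v - u) ^ (k - 2) * u ^ (n - k))"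
        using v by (intro integral_cong) (auto simp: g_def)
      also have "\<dots> = integral {0..v} (\<lambda>u. c * (\<omega> * sqrt u) * (v - u) ^ (k - 2) * u ^ (n - k))"
        using equilibrium_payment_unique[OF \<beta> equilibrium_slope z(1)] K
        unfolding payment_def z(2) c_def by simp
      finally show ?thesis by simp
    qed
  qed
  have "(x / \<omega>)\<^sup>2 < (y / \<omega>)\<^sup>2"
    using xy \<omega> by (intro power_strict_mono divide_strict_right_mono) auto
  moreover have "countable D" unfolding D_def by (rule mono_ctble_discont[OF g])
  ultimately have "uncountable ({(x / \<omega>)\<^sup>2<..<(y / \<omega>)\<^sup>2} - D)"
    using uncountable_minus_countable uncountable_open_interval by blast
  then obtain u where u: "(x / \<omega>)\<^sup>2 < u" "u < (y / \<omega>)\<^sup>2" "u \<notin> D"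
    by (metis DiffD1 DiffD2 countable_empty equals0I greaterThanLessThan_iff)
  have "(y / \<omega>)\<^sup>2 \<le> 1" using xy \<omega> by (intro power_le_one) auto
  then have u01: "0 < u" "u < 1" using u le_less_trans[OF zero_le_power2 u(1)] by auto
  show thesis
  proof (rule that[of "\<omega> * sqrt u"])
    have "x / \<omega> < sqrt u" by (rule real_less_rsqrt[OF u(1)])
    then show "x < \<omega> * sqrt u" using \<omega> by (simp add: field_simps)
    have "sqrt u < y / \<omega>" by (rule real_less_lsqrt) (use u xy \<omega> u01 in auto)
    then show "\<omega> * sqrt u < y" using \<omega> by (simp add: field_simps)
    show "\<beta> (\<omega> * sqrt u) = slope n k * (\<omega> * sqrt u)"
      using f_zero[of u] u01 u(3) by (simp add: f_def g_def c_def)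
  qed
qed

text \<open>Monotonicity squeezes \<open>\<beta> x\<close> between agreement points that approach x
  from either side. Those on the right exist because \<open>x < \<omega>\<close>.\<close>

lemma equilibrium_unique:
  assumes \<beta>: "symmetric_increasing_equilibrium M X n k \<omega> \<beta>" and x: "0 \<le> x" "x < \<omega>"
  shows "\<beta> x = slope n k * x"
proof -
  define c where "c = slope n k"
  have c: "0 < c" unfolding c_def by (rule slope_pos[OF k])
  have mono: "strict_mono_on {0..\<omega>} \<beta>" and nonneg: "\<And>x. x \<in> {0..\<omega>} \<Longrightarrow> 0 \<le> \<beta> x"
    using \<beta> by (auto simp: symmetric_increasing_equilibrium_def symmetric_equilibrium_def)
  have "\<beta> x / c \<le> x"
  proof (rule dense_ge_bounded[OF x(2)])
    fix y assume y: "x < y" "y < \<omega>"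
    obtain t where t: "x < t" "t < y" "\<beta> t = c * t"
      using equilibrium_dense[OF \<beta> x(1) y(1)] y(2) unfolding c_def by auto
    have "\<beta> x < \<beta> t" using t x y by (intro strict_mono_onD[OF mono]) auto
    also have "\<dots> \<le> c * y" using t c by simp
    finally show "\<beta> x / c \<le> y" using c by (simp add: field_simps)
  qed
  \<comment> \<open>There are no values to the left of 0; the lower bound there is the nonnegativity
    of bids.\<close>
  moreover have "x \<le> \<beta> x / c"
  proof (cases "x = 0")
    case False
    then have "0 < x" using x by simp
    then show ?thesis
    proof (rule dense_le_bounded)
      fix y assume y: "0 < y" "y < x"
      obtain t where t: "y < t" "t < x" "\<beta> t = c * t"
        using equilibrium_dense[OF \<beta> _ y(2)] y x unfolding c_def by auto
      have "c * y \<le> \<beta> t" using t c by simp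
      also have "\<beta> t < \<beta> x" using t x y by (intro strict_mono_onD[OF mono]) auto
      finally show "y \<le> \<beta> x / c" using c by (simp add: field_simps)
    qed
  qed (use nonneg[of 0] c \<omega> in simp)
  ultimately have "\<beta> x / c = x" by simp
  then show ?thesis using c by (simp add: c_def field_simps)
qed

end

(* Pointwise uniqueness is claimed on [0, \<omega>): a bidder with value \<omega> already wins with
   probability 1 and, as k >= 2, does not influence its price, so raising the bid at the single
   value \<omega> gives another increasing equilibrium. *)
theorem theorem1:
  fixes M :: "'a measure" and X :: "nat \<Rightarrow> 'a \<Rightarrow> real"
    and n k :: nat and a \<omega> :: real
  assumes "prob_space M"
    and "n \<ge> 3" and "k \<in> {3..n}"
    and "0 < \<omega>" and "0 < a"
    and "\<And>i s. i \<in> {1..n} \<Longrightarrow> s \<in> space M \<Longrightarrow> X i s \<in> {0..\<omega>}"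
    and "prob_space.indep_vars M (\<lambda>_. borel) X {1..n}"
    and "\<And>i x. i \<in> {1..n} \<Longrightarrow> x \<in> {0..\<omega>} \<Longrightarrow> cdf (distr M borel (X i)) x = a * x\<^sup>2 / 2"
  shows "(symmetric_increasing_equilibrium M X n k \<omega> (eq_bid n k) \<and>
          (\<forall>\<beta>. symmetric_increasing_equilibrium M X n k \<omega> \<beta> \<longrightarrow>
                (\<forall>x\<in>{0..<\<omega>}. \<beta> x = eq_bid n k x))) \<and>
         (n + 4 > 2 * k \<longrightarrow>
          (\<forall>x\<in>{0..\<omega>}.
             x + real (k - 2) / (2 * real (n - 2)) * x \<le> eq_bid n k x \<and>
             eq_bid n k x \<le> x + 7 * real (k - 2) / (8 * real (n - 2)) * x))"
proof -
  have k: "3 \<le> k" "k \<le> n" using assms(3) by auto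
  interpret quadratic_auction M X n k a \<omega>
    by (intro quadratic_auction.intro quadratic_auction_axioms.intro assms k)
  have eq: "eq_bid n k = (\<lambda>x. slope n k * x)"
    by (intro ext eq_bid_slope k)
  show ?thesis
  proof (intro conjI impI allI ballI)
    show "symmetric_increasing_equilibrium M X n k \<omega> (eq_bid n k)"
      unfolding eq by (rule equilibrium_slope)
    show "\<beta> x = eq_bid n k x"
      if "symmetric_increasing_equilibrium M X n k \<omega> \<beta>" "x \<in> {0..<\<omega>}" for \<beta> x
      unfolding eq using equilibrium_unique[OF that(1)] that(2) by simp
    fix x assume "n + 4 > 2 * k" and x: "x \<in> {0..\<omega>}"
    then have "(1 + real (k - 2) / (2 * real (n - 2))) * x \<le> slope n k * x"
      "slope n k * x \<le> (1 + 7 * real (k - 2) / (8 * real (n - 2))) * x"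
      using slope_ge[OF k] slope_le[OF k] by (auto intro!: mult_right_mono)
    then show "x + real (k - 2) / (2 * real (n - 2)) * x \<le> eq_bid n k x"
      "eq_bid n k x \<le> x + 7 * real (k - 2) / (8 * real (n - 2)) * x"
      by (simp_all only: eq distrib_right mult_1)
  qed
qed

end
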